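(* Let $f_k=\sum_{\Omega(n)=k}\frac{1}{n\log n}$, where $\Omega(n)$ is the number of prime factors of $n$ counted with multiplicity, and let $$d:=\frac14\prod_{p>2}\Big(1-\frac{2}{p}\Big)^{-1}\Big(1-\frac1p\Big)^2 .$$ Then, uniformly for all integers $k\ge1$, $$f_k=1-\frac{\log 2}{4}\,2^{-k}\Big(dk^2+O\big(k\log(k+1)\big)\Big).$$
   Context: $p$ ranges over primes. The implied constant in $O(\cdot)$ is absolute. *)

theory Defs
  imports "HOL-Analysis.Analysis" "HOL-Computational_Algebra.Primes"
begin

definition prime_Omega :: "nat \<Rightarrow> nat" where
  "prime_Omega n = size (prime_factorization n)"

(* For k \<ge> 1 every index satisfies n \<ge> 2, since prime_Omega 0 = prime_Omega 1 = 0; all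
   terms are then positive. *)
definition f_sum :: "nat \<Rightarrow> real" where
  "f_sum k = (\<Sum>\<^sub>\<infinity>n\<in>{n. prime_Omega n = k}. 1 / (real n * ln (real n)))"

definition d_factor :: "nat \<Rightarrow> real" where
  "d_factor p = inverse (1 - 2 / real p) * (1 - 1 / real p)\<^sup>2"

definition d_const :: real where
  "d_const = 1 / 4 * (\<Prod>p. if prime p \<and> p > 2 then d_factor p else 1)"

(* The product converges absolutely, so prodinf is not a junk value here. *)
lemma abs_convergent_prod_d_factor:
  "abs_convergent_prod (\<lambda>p. if prime p \<and> p > 2 then d_factor p else 1)"
proof -
  have le: "norm (norm ((if prime p \<and> p > 2 then d_factor p else 1) - 1)) \<le> 3 * inverse (real p ^ 2)"
    for p :: nat
  proof (cases "prime p \<and> p > 2")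
    case True
    hence p: "real p \<ge> 3" by linarith
    have eq: "d_factor p - 1 = 1 / (real p * (real p - 2))"
      using p by (simp add: d_factor_def field_simps power2_eq_square)
    have "real p ^ 2 \<le> 3 * (real p * (real p - 2))"
      using p mult_mono[of 3 "real p" "real p" "real p"] by (simp add: power2_eq_square algebra_simps)
    hence "1 / (real p * (real p - 2)) \<le> 3 * inverse (real p ^ 2)"
      using p by (simp add: field_simps)
    thus ?thesis using True p by (simp add: eq)
  qed auto
  have "summable (\<lambda>p. norm ((if prime p \<and> p > 2 then d_factor p else 1) - 1))"
    by (rule summable_comparison_test'[OF summable_mult[OF inverse_power_summable[of 2]], of 0, OF _ le])
      auto
  thus ?thesis by (rule summable_imp_abs_convergent_prod)
qed

end

theory Submission
  imports Defs "HOL-Complex_Analysis.Complex_Analysis" "HOL-Probability.Distributions"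
begin

text \<open>
  Write \<open>P k s\<close> for the sum of \<open>n powr - s\<close> over the \<open>n\<close> with \<open>k\<close> prime factors. Since
  \<open>1 / (n ln n)\<close> is the integral of \<open>n powr - (1 + u)\<close> over \<open>u > 0\<close>, \<open>f_sum k\<close> is the integral of
  \<open>P k (1 + u)\<close>, and the range \<open>u > 1\<close> contributes only \<open>O(2^-k)\<close>. For \<open>u\<close> in \<open>{0<..1}\<close> the
  generating function factors as
  \<open>(\<Sum>k. P k (1 + u) z^k) = u powr - z * (1 - z / 2 powr (1 + u))^-1 * g u z\<close>,
  where \<open>g u\<close> collects the odd primes, is holomorphic in the disc of radius \<open>3\<close> and is
  Lipschitz in \<open>u\<close> at \<open>0\<close>. Cauchy's inequality on the circle of radius \<open>5/2\<close> makes the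
  coefficients of \<open>g u\<close> decay faster than \<open>2^-b\<close>, so with \<open>h i u\<close> the coefficients of the last
  two factors, \<open>h i u = h i 0 - ln 2 * g 0 2 * i * 2^-i * u + ...\<close>, and \<open>P k (1 + u)\<close> is the sum of
  \<open>(- ln u)^j / j! * h (k - j) u\<close> over \<open>j \<le> k\<close>. Since \<open>(- ln u)^j / j!\<close> has integral \<open>1\<close>, and
  \<open>2^-(j + 1)\<close> against \<open>u\<close>, the constant terms give \<open>(\<Sum>i\<le>k. h i 0) = 2 * g 0 1 + O(2^-k) = 1 + O(2^-k)\<close>
  and the linear terms give \<open>- ln 2 / 4 * g 0 2 * k^2 * 2^-k\<close> with \<open>g 0 2 = d_const\<close>.
\<close>

section \<open>Newton's identities for almost primes\<close>

text \<open>The condition \<open>n > 0\<close> keeps 0, whose prime factorization is empty as well,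
  out of \<open>almost_primes 0\<close>.\<close>

definition almost_primes :: "nat \<Rightarrow> nat set" where
  "almost_primes k = {n. n > 0 \<and> prime_Omega n = k}"

definition almost_prime_zeta :: "nat \<Rightarrow> real \<Rightarrow> real" where
  "almost_prime_zeta k s = (\<Sum>\<^sub>\<infinity>n\<in>almost_primes k. real n powr - s)"

definition prime_zeta :: "real \<Rightarrow> real" where
  "prime_zeta s = (\<Sum>\<^sub>\<infinity>p\<in>{p::nat. prime p}. real p powr - s)"

definition odd_prime_zeta :: "real \<Rightarrow> real" where
  "odd_prime_zeta s = (\<Sum>\<^sub>\<infinity>p\<in>{p::nat. prime p \<and> p > 2}. real p powr - s)"

text \<open>Riemann's zeta function for real \<open>s > 1\<close>; the term at \<open>n = 0\<close>
  vanishes because \<open>0 powr - s = 0\<close>.\<close>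

definition real_zeta :: "real \<Rightarrow> real" where
  "real_zeta s = (\<Sum>n. real n powr - s)"

lemma summable_on_powr:
  assumes "s > 1"
  shows "(\<lambda>n::nat. real n powr - s) summable_on A"
proof -
  have "(\<lambda>n::nat. real n powr - s) summable_on UNIV"
    using assms by (subst summable_on_UNIV_nonneg_real_iff) (auto simp: summable_real_powr_iff)
  thus ?thesis by (rule summable_on_subset) auto
qed

lemma summable_powr:
  assumes "s > 1"
  shows "summable (\<lambda>n::nat. real n powr - s)"
  using assms by (auto simp: summable_real_powr_iff)

lemma prime_zeta_eq:
  assumes "s > 1"
  shows "prime_zeta s = 2 powr - s + odd_prime_zeta s"
proof -
  have eq: "{p::nat. prime p} = insert 2 {p. prime p \<and> p > 2}"
    using prime_gt_1_nat by (auto intro: order.strict_iff_order[THEN iffD2] simp: Suc_le_eq)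
       (metis One_nat_def Suc_1 Suc_leI le_neq_implies_less prime_gt_1_nat)
  show ?thesis
    unfolding prime_zeta_def odd_prime_zeta_def eq
    by (subst infsum_insert) (auto intro!: summable_on_powr assms)
qed

lemma prime_Omega_mult_prime_power:
  assumes "prime p" "m > 0"
  shows "prime_Omega (p ^ j * m) = j + prime_Omega m"
  using assms unfolding prime_Omega_def
  by (subst prime_factorization_mult) (auto simp: prime_factorization_prime_power)

text \<open>A prime contributes the exponents from 1 to its multiplicity. This count produces the
  factor \<open>k\<close> in Newton's identities.\<close>

lemma card_prime_power_divisors:
  assumes "n > 0"
  shows "finite {(p,j). prime p \<and> 1 \<le> j \<and> p ^ j dvd n}" (is "finite ?D")
    and "card {(p,j). prime p \<and> 1 \<le> j \<and> p ^ j dvd n} = prime_Omega n"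
proof -
  have eq: "?D = Sigma (prime_factors n) (\<lambda>p. {1..multiplicity p n})"
  proof (intro equalityI subsetI; clarsimp)
    fix p j assume "prime p" "Suc 0 \<le> j" "p ^ j dvd n"
    thus "p \<in># prime_factorization n \<and> j \<le> multiplicity p n"
      using assms 
      by (metis One_nat_def Suc_le_eq bot_nat_0.not_eq_extremum dvd_power dvd_trans
          multiplicity_geI not_prime_unit prime_factors_dvd mem_Collect_eq)
  next
    fix p j assume "p \<in># prime_factorization n" "Suc 0 \<le> j" "j \<le> multiplicity p n"
    thus "prime p \<and> p ^ j dvd n"
      by (auto intro: multiplicity_dvd')
  qed
  show "finite ?D" unfolding eq by auto
  have "card ?D = (\<Sum>p\<in>prime_factors n. multiplicity p n)"
    unfolding eq by (subst card_SigmaI) auto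
  also have "\<dots> = (\<Sum>p\<in>prime_factors n. count (prime_factorization n) p)"
    by (intro sum.cong) (auto simp: count_prime_factorization)
  also have "\<dots> = prime_Omega n"
    by (simp add: prime_Omega_def size_multiset_overloaded_eq)
  finally show "card ?D = prime_Omega n" .
qed

lemma has_sum_product_nonneg:
  fixes f :: "'a \<Rightarrow> real" and g :: "'b \<Rightarrow> real"
  assumes "f summable_on A" "g summable_on B"
    and "\<And>x. x \<in> A \<Longrightarrow> f x \<ge> 0" "\<And>y. y \<in> B \<Longrightarrow> g y \<ge> 0"
  shows "((\<lambda>(x,y). f x * g y) has_sum (infsum f A * infsum g B)) (A \<times> B)"
proof -
  have inner: "((\<lambda>y. f x * g y) has_sum (f x * infsum g B)) B" for x
    using assms(2) by (intro has_sum_cmult_right has_sum_infsum)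
  have outer: "((\<lambda>x. f x * infsum g B) has_sum (infsum f A * infsum g B)) A"
    using assms(1) by (intro has_sum_cmult_left has_sum_infsum)
  have "(\<lambda>(x,y). f x * g y) summable_on (A \<times> B)"
    using assms inner has_sum_imp_summable[OF outer]
    by (intro summable_on_SigmaI[where g = "\<lambda>x. f x * infsum g B"]) auto
  with inner outer show ?thesis
    by (intro has_sum_SigmaI) auto
qed

text \<open>Newton's identities for the variables \<open>p powr - s\<close>: both sides sum \<open>n powr - s\<close> over the
  triples \<open>(n, p, j)\<close> with \<open>n\<close> in \<open>almost_primes k\<close>, \<open>j \<ge> 1\<close> and \<open>p ^ j dvd n\<close>.\<close>
lemma almost_prime_zeta_newton:
  assumes s: "s > 1"
  shows "real k * almost_prime_zeta k s =
         (\<Sum>j=1..k. prime_zeta (real j * s) * almost_prime_zeta (k - j) s)"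
proof -
  define D where "D = (\<lambda>n::nat. {(p::nat,j::nat). prime p \<and> 1 \<le> j \<and> p ^ j dvd n})"
  define f where "f = (\<lambda>(n::nat, _::nat\<times>nat). real n powr - s)"
  define h where "h = (\<lambda>(j::nat, (p::nat, m::nat)). real p powr - (real j * s) * real m powr - s)"
  have inner: "((\<lambda>y. f (n, y)) has_sum real k * real n powr - s) (D n)"
    if "n \<in> almost_primes k" for n
    using that card_prime_power_divisors[of n] 
    by (intro has_sum_finiteI) (auto simp: f_def D_def almost_primes_def)
  have outer: "((\<lambda>n. real k * real n powr - s) has_sum (real k * almost_prime_zeta k s)) (almost_primes k)"
    unfolding almost_prime_zeta_def by (intro has_sum_cmult_right has_sum_infsum summable_on_powr s)
  have "f summable_on Sigma (almost_primes k) D"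
    using inner has_sum_imp_summable[OF outer] by (intro summable_on_SigmaI) (auto simp: f_def)
  with inner outer have "(f has_sum (real k * almost_prime_zeta k s)) (Sigma (almost_primes k) D)"
    by (intro has_sum_SigmaI) auto
  \<comment> \<open>\<open>n = p ^ j * m\<close> trades the triple for \<open>(j, p, m)\<close>;
    \<open>m\<close> may still be divisible by \<open>p\<close>, so it runs over all of
    \<open>almost_primes (k - j)\<close>.\<close>
  also have "?this \<longleftrightarrow> (h has_sum (real k * almost_prime_zeta k s))
      (Sigma {1..k} (\<lambda>j. {p. prime p} \<times> almost_primes (k - j)))"
  proof (rule has_sum_reindex_bij_witness
      [of _ "\<lambda>(j,(p,m)). (p ^ j * m, (p, j))" "\<lambda>(n,(p,j)). (j,(p,n div p ^ j))"])
    fix a assume a: "a \<in> Sigma (almost_primes k) D"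
    then obtain n p j where [simp]: "a = (n,(p,j))" and n: "n > 0" "prime_Omega n = k"
      and p: "prime p" "1 \<le> j" "p ^ j dvd n"
      by (auto simp: D_def almost_primes_def)
    from p obtain m where m: "n = p ^ j * m" by (auto elim: dvdE)
    have m0: "m > 0" and p0: "p > 0" using n m p prime_gt_0_nat by (auto intro!: Nat.gr0I)
    have k: "k = j + prime_Omega m"
      using prime_Omega_mult_prime_power[OF p(1) m0, of j] n m by simp
    show "(case (case a of (n,(p,j)) \<Rightarrow> (j,(p,n div p ^ j))) of (j,(p,m)) \<Rightarrow> (p ^ j * m, (p, j))) = a"
      using m p0 by simp
    show "(case a of (n,(p,j)) \<Rightarrow> (j,(p,n div p ^ j))) \<in> Sigma {1..k} (\<lambda>j. {p. prime p} \<times> almost_primes (k - j))"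
      using m p0 k m0 p by (auto simp: almost_primes_def)
    show "h (case a of (n,(p,j)) \<Rightarrow> (j,(p,n div p ^ j))) = f a"
      using m p0 m0 by (simp add: h_def f_def powr_mult powr_powr flip: powr_realpow)
  next
    fix b assume b: "(b::nat\<times>nat\<times>nat) \<in> Sigma {1..k} (\<lambda>j. {p. prime p} \<times> almost_primes (k - j))"
    then obtain j p m where [simp]: "b = (j,(p::nat,m))" and j: "1 \<le> j" "j \<le> k" and p: "prime p"
      and m: "m > 0" "prime_Omega m = k - j"
      by (auto simp: almost_primes_def)
    have p0: "p > 0" using p prime_gt_0_nat by auto
    show "(case (case b of (j,(p,m)) \<Rightarrow> (p ^ j * m, (p, j))) of (n,(p,j)) \<Rightarrow> (j,(p,n div p ^ j))) = b"
      using p0 by simp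
    show "(case b of (j,(p,m)) \<Rightarrow> (p ^ j * m, (p, j))) \<in> Sigma (almost_primes k) D"
      using p0 p j m prime_Omega_mult_prime_power[OF p m(1), of j] by (auto simp: almost_primes_def D_def)
  qed auto
  finally have T: "(h has_sum (real k * almost_prime_zeta k s))
      (Sigma {1..k} (\<lambda>j. {p. prime p} \<times> almost_primes (k - j)))" .
  have "((\<lambda>j. prime_zeta (real j * s) * almost_prime_zeta (k - j) s) has_sum
      (real k * almost_prime_zeta k s)) {1..k}"
  proof (rule has_sum_SigmaD[OF T])
    fix j assume "j \<in> {1..k}"
    hence "1 * s \<le> real j * s" using s by (intro mult_right_mono) auto
    hence "real j * s > 1" using s by linarith
    hence "((\<lambda>(p,m). real p powr - (real j * s) * real m powr - s) has_sum
           (prime_zeta (real j * s) * almost_prime_zeta (k - j) s)) ({p. prime p} \<times> almost_primes (k - j))"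
      unfolding prime_zeta_def almost_prime_zeta_def
      by (intro has_sum_product_nonneg summable_on_powr s) auto
    thus "((\<lambda>y. h (j, y)) has_sum (prime_zeta (real j * s) * almost_prime_zeta (k - j) s))
        ({p. prime p} \<times> almost_primes (k - j))"
      by (simp add: h_def case_prod_unfold)
  qed
  thus ?thesis by (simp add: has_sum_finite_iff)
qed

lemma almost_prime_zeta_0: "almost_prime_zeta 0 s = 1"
proof -
  have "almost_primes 0 = {1}"
    by (auto simp: almost_primes_def prime_Omega_def prime_factorization_empty_iff)
  thus ?thesis by (simp add: almost_prime_zeta_def)
qed

text \<open>Each positive integer lies in exactly one \<open>almost_primes k\<close>, so this
  regroups the zeta series by \<open>prime_Omega\<close>.\<close>

lemma sums_almost_prime_zeta:
  assumes s: "s > 1"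
  shows "(\<lambda>k. almost_prime_zeta k s) sums real_zeta s"
proof -
  have "((\<lambda>n::nat. real n powr - s) has_sum real_zeta s) UNIV"
    unfolding real_zeta_def by (intro sums_nonneg_imp_has_sum summable_sums summable_powr s) auto
  hence "((\<lambda>n::nat. real n powr - s) has_sum real_zeta s) {0<..}"
    by (rule has_sum_cong_neutral[THEN iffD1, rotated -1]) auto
  also have "?this \<longleftrightarrow> ((\<lambda>(k::nat,n::nat). real n powr - s) has_sum real_zeta s) (Sigma UNIV almost_primes)"
    by (rule has_sum_reindex_bij_witness[of _ snd "\<lambda>n. (prime_Omega n, n)"])
       (auto simp: almost_primes_def)
  finally have "((\<lambda>k. almost_prime_zeta k s) has_sum real_zeta s) UNIV"
    by (rule has_sum_SigmaD) (auto simp: almost_prime_zeta_def intro!: has_sum_infsum summable_on_powr s)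
  thus ?thesis by (rule has_sum_imp_sums)
qed

section \<open>Factorisation of the generating function\<close>

text \<open>Coefficients in \<open>z\<close> of the sum of
  \<open>- ln (1 - z * p powr - (1 + u))\<close> over odd primes, without the linear one, which
  diverges as \<open>u\<close> tends to 0 and is treated in \<open>lin_coeff\<close>.\<close>

definition tail_coeff :: "real \<Rightarrow> nat \<Rightarrow> real" where
  "tail_coeff u m = (if m \<ge> 2 then odd_prime_zeta (real m * (1 + u)) / real m else 0)"

definition tail_fps :: "real \<Rightarrow> complex fps" where
  "tail_fps u = Abs_fps (\<lambda>m. of_real (tail_coeff u m))"

definition tail_val :: "real \<Rightarrow> real \<Rightarrow> real" where
  "tail_val u x = (\<Sum>m. tail_coeff u m * x ^ m)"

text \<open>The value at \<open>u = 0\<close> is the limit as \<open>u\<close> tends to \<open>0\<close>: the simple pole of the zeta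
  function cancels \<open>ln u\<close>, and Euler's product supplies the constant.\<close>
definition lin_coeff :: "real \<Rightarrow> real" where
  "lin_coeff u = (if u = 0 then - ln 2 - tail_val 0 1 else odd_prime_zeta (1 + u) + ln u)"

text \<open>The factor \<open>g u\<close> of the overview: for \<open>u > 0\<close> it is
  \<open>u powr z\<close> times the product of \<open>(1 - z * p powr - (1 + u))^-1\<close> over odd
  primes, with the logarithm expanded.\<close>

definition reg_fun :: "real \<Rightarrow> complex \<Rightarrow> complex" where
  "reg_fun u z = exp (z * of_real (lin_coeff u) + eval_fps (tail_fps u) z)"

definition reg_fps :: "real \<Rightarrow> complex fps" where
  "reg_fps u = fps_expansion (reg_fun u) 0"

definition reg_coeff :: "real \<Rightarrow> nat \<Rightarrow> real" where
  "reg_coeff u b = Re (fps_nth (reg_fps u) b)"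

text \<open>The \<open>h i u\<close> of the overview: the Cauchy product of the geometric series of
  the prime 2 with the regular factor.\<close>

definition geo_coeff :: "real \<Rightarrow> nat \<Rightarrow> real" where
  "geo_coeff u i = (\<Sum>a=0..i. (2 powr - (1 + u)) ^ a * reg_coeff u (i - a))"

section \<open>Size of the odd prime tail and its dependence on \<open>u\<close>\<close>

lemma has_sum_diff_real:
  fixes f g :: "'a \<Rightarrow> real"
  assumes "(f has_sum a) A" "(g has_sum b) A"
  shows "((\<lambda>x. f x - g x) has_sum (a - b)) A"
  using has_sum_add[OF assms(1) has_sum_cmult_right[OF assms(2), of "-1"]] by simp

text \<open>Two of the \<open>m\<close> factors \<open>1 / p\<close> are kept and the others bounded
  by \<open>1 / 3\<close>, which gives \<open>9 / 3 ^ m\<close>. Varying \<open>u\<close> costs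
  \<open>ln p\<close>, at most \<open>2 * p powr (1/2)\<close>; the exponent \<open>3/2\<close> left
  over still makes the sum over primes converge.\<close>

lemma prime_power_bounds:
  assumes p: "p \<ge> (3::nat)" and m: "m \<ge> 2" and u: "u \<ge> 0"
  shows "real p powr - (real m * (1 + u)) \<le> 9 / 3 ^ m * real p powr - (3/2)"
    and "real p powr - (real m * (1 + 0)) - real p powr - (real m * (1 + u))
           \<le> 18 * (real m * u) / 3 ^ m * real p powr - (3/2)"
    and "real p powr - (real m * (1 + u)) \<le> real p powr - (real m * (1 + 0))"
proof -
  show mono: "real p powr - (real m * (1 + u)) \<le> real p powr - (real m * (1 + 0))"
    using p u by (intro powr_mono) (auto intro: mult_left_mono[of 1 "1+u" "real m", simplified])
  have "real p powr - real m = real p powr - (2::real) * real p powr - real (m - 2)"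
    using m by (simp add: of_nat_diff flip: powr_add)
  also have "\<dots> \<le> real p powr - (2::real) * 3 powr - real (m - 2)"
    using p by (intro mult_left_mono powr_mono2') auto
  also have "(3::real) powr - real (m - 2) = 9 / 3 ^ m"
    using m by (simp add: of_nat_diff powr_diff powr_realpow powr_minus flip: powr_numeral)
  finally have b: "real p powr - real m \<le> real p powr - (2::real) * (9 / 3 ^ m)" .
  have "real p powr - (2::real) \<le> real p powr - (3/2)"
    using p by (intro powr_mono) auto
  hence "real p powr - (2::real) * (9 / 3 ^ m) \<le> real p powr - (3/2) * (9 / 3 ^ m)"
    by (intro mult_right_mono) auto
  with b have "real p powr - (real m * (1 + 0)) \<le> 9 / 3 ^ m * real p powr - (3/2)"
    by (simp add: mult.commute)
  with mono show "real p powr - (real m * (1 + u)) \<le> 9 / 3 ^ m * real p powr - (3/2)"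
    by (rule order.trans)
  have "1 - real p powr - (real m * u) \<le> real m * u * ln (real p)"
    using p exp_ge_add_one_self[of "- (real m * u * ln (real p))"] by (simp add: powr_def)
  also have "\<dots> \<le> real m * u * (real p powr (1/2) / (1/2))"
    using p u by (intro mult_left_mono ln_powr_bound) auto
  finally have c: "1 - real p powr - (real m * u) \<le> 2 * (real m * u) * real p powr (1/2)"
    by simp
  have d: "0 \<le> 1 - real p powr - (real m * u)"
    using powr_mono[of "- (real m * u)" 0 "real p"] p u by simp
  have "real p powr - (real m * (1 + 0)) - real p powr - (real m * (1 + u)) =
        real p powr - real m * (1 - real p powr - (real m * u))"
    by (simp add: algebra_simps flip: powr_add)
  also have "\<dots> \<le> (real p powr - (2::real) * (9 / 3 ^ m)) * (2 * (real m * u) * real p powr (1/2))"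
    by (intro mult_mono b c d) auto
  also have "\<dots> = 18 * (real m * u) / 3 ^ m * (real p powr - (2::real) * real p powr (1/2))"
    by simp
  also have "real p powr - (2::real) * real p powr (1/2) = real p powr - (3/2)"
    by (simp flip: powr_add)
  finally show "real p powr - (real m * (1 + 0)) - real p powr - (real m * (1 + u))
           \<le> 18 * (real m * u) / 3 ^ m * real p powr - (3/2)" .
qed

lemma tail_coeff_nonneg: "tail_coeff u m \<ge> 0"
  unfolding tail_coeff_def odd_prime_zeta_def by (auto intro!: divide_nonneg_nonneg infsum_nonneg)

text \<open>The rate \<open>1 / 3 ^ m\<close> comes from the smallest odd prime. The factor
  \<open>m\<close> lost in the Lipschitz bound is regained from the denominator of
  \<open>tail_coeff\<close>.\<close>

lemma tail_coeff_bounds: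
  obtains K where "K > 0"
    "\<And>u m. u \<ge> 0 \<Longrightarrow> \<bar>tail_coeff u m\<bar> \<le> K / 3 ^ m"
    "\<And>u m. u \<ge> 0 \<Longrightarrow> \<bar>tail_coeff u m - tail_coeff 0 m\<bar> \<le> K * u / 3 ^ m"
proof
  define Q where "Q = {p::nat. prime p \<and> p > 2}"
  define S where "S = (\<Sum>\<^sub>\<infinity>p\<in>Q. real p powr - (3/2))"
  have sm: "(\<lambda>p::nat. real p powr - (3/2)) summable_on Q"
    by (rule summable_on_powr) simp
  have S0: "S \<ge> 0" unfolding S_def by (intro infsum_nonneg) auto
  show "18 * S + 1 > 0" using S0 by simp
  fix u :: real and m :: nat
  assume u: "u \<ge> 0"
  have s: "real m * (1 + v) > 1" if "m \<ge> 2" "v \<ge> 0" for v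
    using mult_mono[of 2 "real m" 1 "1 + v"] that by simp
  show "\<bar>tail_coeff u m\<bar> \<le> (18 * S + 1) / 3 ^ m"
  proof (cases "m \<ge> 2")
    case True
    have "odd_prime_zeta (real m * (1 + u)) \<le> (\<Sum>\<^sub>\<infinity>p\<in>Q. 9 / 3 ^ m * real p powr - (3/2))"
      unfolding odd_prime_zeta_def Q_def[symmetric]
      by (intro infsum_mono summable_on_powr s True u summable_on_cmult_right sm prime_power_bounds(1))
         (auto simp: Q_def)
    also have "\<dots> = 9 / 3 ^ m * S"
      unfolding S_def by (intro infsum_cmult_right sm)
    finally have "odd_prime_zeta (real m * (1 + u)) \<le> 9 / 3 ^ m * S" .
    moreover have "odd_prime_zeta (real m * (1 + u)) / real m \<le> odd_prime_zeta (real m * (1 + u)) / 1"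
      using True unfolding odd_prime_zeta_def by (intro divide_left_mono infsum_nonneg) auto
    ultimately have "tail_coeff u m \<le> 9 / 3 ^ m * S"
      using True by (simp add: tail_coeff_def)
    also have "\<dots> \<le> (18 * S + 1) / 3 ^ m"
      using S0 by (simp add: field_simps)
    finally show ?thesis using tail_coeff_nonneg[of u m] by simp
  qed (use S0 in \<open>simp add: tail_coeff_def\<close>)
  show "\<bar>tail_coeff u m - tail_coeff 0 m\<bar> \<le> (18 * S + 1) * u / 3 ^ m"
  proof (cases "m \<ge> 2")
    case True
    have le: "odd_prime_zeta (real m * (1 + u)) \<le> odd_prime_zeta (real m * (1 + 0))"
      unfolding odd_prime_zeta_def Q_def[symmetric]
      by (intro infsum_mono summable_on_powr s True u order.refl prime_power_bounds(3)) (auto simp: Q_def)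
    have sm': "(\<lambda>p. real p powr - (real m * (1 + v))) summable_on Q" if "v \<ge> 0" for v
      by (intro summable_on_powr s True that)
    have "odd_prime_zeta (real m * (1 + 0)) - odd_prime_zeta (real m * (1 + u)) =
      (\<Sum>\<^sub>\<infinity>p\<in>Q. real p powr - (real m * (1 + 0)) - real p powr - (real m * (1 + u)))"
      unfolding odd_prime_zeta_def Q_def[symmetric]
      by (intro infsumI[symmetric] has_sum_diff_real has_sum_infsum sm' u order.refl)
    also have "\<dots> \<le> (\<Sum>\<^sub>\<infinity>p\<in>Q. 18 * (real m * u) / 3 ^ m * real p powr - (3/2))"
      by (intro infsum_mono has_sum_imp_summable[OF has_sum_diff_real[OF has_sum_infsum has_sum_infsum]]
            sm' u order.refl summable_on_cmult_right sm prime_power_bounds(2) True)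
         (auto simp: Q_def)
    also have "\<dots> = 18 * (real m * u) / 3 ^ m * S"
      unfolding S_def by (intro infsum_cmult_right sm)
    finally have "\<bar>odd_prime_zeta (real m * (1 + u)) - odd_prime_zeta (real m * (1 + 0))\<bar> 
        \<le> 18 * (real m * u) / 3 ^ m * S" using le by linarith
    hence "\<bar>odd_prime_zeta (real m * (1 + u)) - odd_prime_zeta (real m * (1 + 0))\<bar> / real m
        \<le> 18 * (real m * u) / 3 ^ m * S / real m"
      by (intro divide_right_mono) auto
    also have "\<dots> = 18 * S * u / 3 ^ m" using True by simp
    also have "\<dots> \<le> (18 * S + 1) * u / 3 ^ m" using u by (intro divide_right_mono mult_right_mono) auto
    finally show ?thesis
      using True by (simp add: tail_coeff_def flip: diff_divide_distrib)
  qed (use S0 u in \<open>simp add: tail_coeff_def\<close>)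
qed

lemma summable_tail_coeff:
  assumes "u \<ge> 0" "norm (z :: complex) < 3"
  shows "summable (\<lambda>m. of_real (tail_coeff u m) * z ^ m)"
proof -
  obtain K where K: "K > 0" "\<And>u m. u \<ge> 0 \<Longrightarrow> \<bar>tail_coeff u m\<bar> \<le> K / 3 ^ m"
    using tail_coeff_bounds by metis
  show ?thesis
  proof (rule summable_comparison_test')
    show "summable (\<lambda>m. K * (norm z / 3) ^ m)"
      using assms by (intro summable_mult summable_geometric) auto
    show "norm (of_real (tail_coeff u m) * z ^ m) \<le> K * (norm z / 3) ^ m" for m
      using K(2)[OF assms(1), of m] mult_right_mono[of "\<bar>tail_coeff u m\<bar>" "K / 3 ^ m" "norm z ^ m"]
      by (simp add: norm_mult norm_power power_divide)
  qed
qed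

lemma tail_fps_conv_radius:
  assumes "u \<ge> 0"
  shows "fps_conv_radius (tail_fps u) \<ge> 3"
  unfolding fps_conv_radius_def tail_fps_def
proof (rule conv_radius_geI_ex')
  fix r :: real assume r: "0 < r" "ereal r < 3"
  hence "r < 3" by simp
  thus "summable (\<lambda>n. fps_nth (Abs_fps (\<lambda>m. complex_of_real (tail_coeff u m))) n * of_real r ^ n)"
    using summable_tail_coeff[OF assms, of "of_real r"] r by simp
qed

lemma eval_tail_fps_real:
  assumes "u \<ge> 0" "\<bar>x\<bar> < 3"
  shows "eval_fps (tail_fps u) (of_real x) = of_real (tail_val u x)"
    and "(\<lambda>m. tail_coeff u m * x ^ m) sums tail_val u x"
proof -
  have "summable (\<lambda>m. of_real (tail_coeff u m) * (of_real x :: complex) ^ m)"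
    using assms by (intro summable_tail_coeff) auto
  hence "summable (\<lambda>m. complex_of_real (tail_coeff u m * x ^ m))" by simp
  hence s: "summable (\<lambda>m. tail_coeff u m * x ^ m)" by (subst (asm) summable_complex_of_real)
  thus "(\<lambda>m. tail_coeff u m * x ^ m) sums tail_val u x"
    unfolding tail_val_def by (rule summable_sums)
  show "eval_fps (tail_fps u) (of_real x) = of_real (tail_val u x)"
    unfolding eval_fps_def tail_fps_def tail_val_def using suminf_of_real[OF s, where 'a = complex]
    by simp
qed

section \<open>The regular factor as a power series\<close>

lemma reg_fun_holomorphic:
  assumes "u \<ge> 0"
  shows "reg_fun u holomorphic_on ball 0 3"
  unfolding reg_fun_def [abs_def]
  by (intro holomorphic_intros ball_eball_mono) (use tail_fps_conv_radius[OF assms] in simp)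

lemma reg_fun_expansion:
  assumes "u \<ge> 0"
  shows "reg_fun u has_fps_expansion reg_fps u"
  unfolding reg_fps_def by (rule has_fps_expansion_fps_expansion[OF _ _ reg_fun_holomorphic[OF assms]]) auto

lemma reg_fps_conv_radius:
  assumes "u \<ge> 0"
  shows "fps_conv_radius (reg_fps u) \<ge> 3"
  unfolding reg_fps_def using reg_fun_holomorphic[OF assms]
  by (intro conv_radius_fps_expansion) auto

lemma eval_reg_fps:
  assumes "u \<ge> 0" "norm z < 3"
  shows "eval_fps (reg_fps u) z = reg_fun u z"
  using has_fps_expansion_imp_eval_fps_eq[OF reg_fun_expansion[OF assms(1)] assms(2) reg_fun_holomorphic[OF assms(1)]] .

text \<open>Logarithmic derivative of an exponential, computed for functions near 0 and carried over
  to formal series by uniqueness of expansions.\<close>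

lemma fps_deriv_reg_fps:
  assumes "u \<ge> 0"
  shows "fps_deriv (reg_fps u) = (fps_const (of_real (lin_coeff u)) + fps_deriv (tail_fps u)) * reg_fps u"
proof (rule fps_expansion_unique_complex)
  have r: "fps_conv_radius (tail_fps u) > 0"
    using tail_fps_conv_radius[OF assms] by (rule less_le_trans[rotated]) auto
  show "deriv (reg_fun u) has_fps_expansion fps_deriv (reg_fps u)"
    by (intro has_fps_expansion_deriv reg_fun_expansion assms)
  have "(\<lambda>z. (of_real (lin_coeff u) + deriv (eval_fps (tail_fps u)) z) * reg_fun u z) has_fps_expansion
     (fps_const (of_real (lin_coeff u)) + fps_deriv (tail_fps u)) * reg_fps u"
    by (intro fps_expansion_intros reg_fun_expansion assms eval_fps_has_fps_expansion r)
  also have "?this \<longleftrightarrow> deriv (reg_fun u) has_fps_expansion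
     (fps_const (of_real (lin_coeff u)) + fps_deriv (tail_fps u)) * reg_fps u"
  proof (rule has_fps_expansion_cong)
    have "eventually (\<lambda>z. z \<in> ball (0::complex) 3) (nhds 0)"
      by (intro eventually_nhds_in_open) auto
    thus "\<forall>\<^sub>F z in nhds 0. (of_real (lin_coeff u) + deriv (eval_fps (tail_fps u)) z) * reg_fun u z = deriv (reg_fun u) z"
    proof eventually_elim
      case (elim z)
      have r': "ereal (norm z) < fps_conv_radius (tail_fps u)"
        using elim by (intro less_le_trans[OF _ tail_fps_conv_radius[OF assms]]) simp
      have d: "(eval_fps (tail_fps u) has_field_derivative deriv (eval_fps (tail_fps u)) z) (at z)"
        using has_field_derivative_eval_fps[OF r'] unfolding eval_fps_deriv[OF r'] .
      have "(reg_fun u has_field_derivative (of_real (lin_coeff u) + deriv (eval_fps (tail_fps u)) z) * reg_fun u z) (at z)"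
        unfolding reg_fun_def [abs_def] by (auto intro!: derivative_eq_intros r' simp: eval_fps_deriv[OF r'])
      thus ?case by (simp add: DERIV_imp_deriv)
    qed
  qed auto
  finally show "deriv (reg_fun u) has_fps_expansion
     (fps_const (of_real (lin_coeff u)) + fps_deriv (tail_fps u)) * reg_fps u" .
qed

definition geo_fps :: "complex \<Rightarrow> complex fps" where
  "geo_fps q = Abs_fps (\<lambda>a. q ^ a)"

text \<open>Logarithmic derivative of \<open>1 / (1 - q * X)\<close>; its coefficients
  \<open>q ^ Suc a\<close> supply the prime 2 in Newton's recurrence.\<close>

lemma fps_deriv_geo_fps:
  "fps_deriv (geo_fps q) = Abs_fps (\<lambda>a. q ^ Suc a) * geo_fps q"
proof (rule fps_ext)
  fix n
  have "(\<Sum>i=0..n. q ^ Suc i * q ^ (n - i)) = (\<Sum>i=0..n. q ^ Suc n)"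
    by (intro sum.cong) (auto simp flip: power_add power_Suc)
  thus "fps_nth (fps_deriv (geo_fps q)) n = fps_nth (Abs_fps (\<lambda>a. q ^ Suc a) * geo_fps q) n"
    by (simp add: geo_fps_def fps_mult_nth)
qed

lemma eval_geo_fps:
  assumes "norm q \<le> 1 / 2"
  shows "eval_fps (geo_fps q) 1 = 1 / (1 - q)" "fps_conv_radius (geo_fps q) > 1"
proof -
  \<comment> \<open>Any radius strictly between 1 and 2 would do, since \<open>norm q\<close> is at
    most \<open>1/2\<close>.\<close>
  define w :: complex where "w = of_real (3/2)"
  have w: "norm w = 3/2" by (simp add: w_def del: of_real_divide)
  have "summable (\<lambda>a. (q * w) ^ a)"
    using assms by (intro summable_geometric) (simp add: norm_mult w)
  hence "ereal (norm w) \<le> fps_conv_radius (geo_fps q)"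
    unfolding fps_conv_radius_def geo_fps_def by (intro conv_radius_geI) (simp add: power_mult_distrib)
  thus "fps_conv_radius (geo_fps q) > 1" by (rule less_le_trans[rotated]) (simp add: w)
  show "eval_fps (geo_fps q) 1 = 1 / (1 - q)"
    unfolding eval_fps_def geo_fps_def using assms by (simp add: suminf_geometric)
qed

text \<open>A power series with constant coefficient 1 is determined by its logarithmic derivative.
  Here the coefficients of that derivative are prime zeta values, so the resulting recurrence is
  Newton's identities.\<close>

lemma almost_prime_zeta_fps:
  assumes u: "u > 0"
  shows "fps_nth (fps_exp (of_real (- ln u)) * geo_fps (of_real (2 powr - (1 + u))) * reg_fps u) k
         = of_real (almost_prime_zeta k (1 + u))"
proof -
  define q where "q = complex_of_real (2 powr - (1 + u))"
  define L where "L = complex_of_real (- ln u)"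
  define A where "A = fps_exp L * geo_fps q * reg_fps u"
  define D where "D = fps_const L + Abs_fps (\<lambda>a. q ^ Suc a) +
                     (fps_const (of_real (lin_coeff u)) + fps_deriv (tail_fps u))"
  have "fps_deriv A = D * A"
    using u by (simp add: A_def D_def fps_deriv_geo_fps fps_deriv_reg_fps algebra_simps)
  hence "fps_nth (fps_deriv A) n = fps_nth (D * A) n" for n by simp
  hence rec: "of_nat (Suc n) * fps_nth A (Suc n) = (\<Sum>i=0..n. fps_nth D i * fps_nth A (n - i))" for n
    unfolding fps_mult_nth fps_deriv_nth Suc_eq_plus1 .
  \<comment> \<open>At \<open>i = 0\<close> the \<open>- ln u\<close> of the exponential factor
    cancels the \<open>ln u\<close> in \<open>lin_coeff\<close>; for larger \<open>i\<close>,
    differentiation removes the division by \<open>m\<close> in \<open>tail_coeff\<close>.\<close>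
  have D: "fps_nth D i = of_real (prime_zeta (real (Suc i) * (1 + u)))" for i
  proof (cases i)
    case 0
    thus ?thesis using u
      by (simp add: D_def L_def q_def lin_coeff_def tail_fps_def tail_coeff_def prime_zeta_eq)
  next
    case (Suc j)
    have "1 < real (Suc i) * (1 + u)"
      using u by (simp add: algebra_simps add_pos_nonneg)
    moreover have "(2 powr - (1 + u)) ^ Suc i = 2 powr - (real (Suc i) * (1 + u))"
      by (subst powr_power) (simp_all add: algebra_simps del: power_Suc)
    ultimately show ?thesis using u Suc
      by (simp add: D_def L_def q_def lin_coeff_def tail_fps_def tail_coeff_def prime_zeta_eq
            del: power_Suc of_nat_Suc flip: of_real_power)
  qed
  have A0: "fps_nth A 0 = 1"
    using u by (simp add: A_def geo_fps_def fps_nth_fps_expansion[OF reg_fun_expansion] reg_fun_def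
        eval_fps_at_0 tail_fps_def tail_coeff_def)
  have "fps_nth A k = of_real (almost_prime_zeta k (1 + u))"
  proof (induction k rule: less_induct)
    case (less k)
    show ?case
    proof (cases k)
      case 0
      thus ?thesis by (simp add: A0 almost_prime_zeta_0)
    next
      case (Suc n)
      have "of_nat (Suc n) * fps_nth A (Suc n) = (\<Sum>i=0..n. fps_nth D i * fps_nth A (n - i))"
        by (rule rec)
      also have "\<dots> = (\<Sum>i=0..n. of_real (prime_zeta (real (Suc i) * (1 + u)) * almost_prime_zeta (n - i) (1 + u)))"
        using Suc by (intro sum.cong refl) (subst less.IH, auto simp: D)
      also have "\<dots> = of_real (\<Sum>i=0..n. prime_zeta (real (Suc i) * (1 + u)) * almost_prime_zeta (Suc n - Suc i) (1 + u))"
        by simp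
      also have "(\<Sum>i=0..n. prime_zeta (real (Suc i) * (1 + u)) * almost_prime_zeta (Suc n - Suc i) (1 + u))
         = (\<Sum>j=1..Suc n. prime_zeta (real j * (1 + u)) * almost_prime_zeta (Suc n - j) (1 + u))"
        using sum.shift_bounds_cl_Suc_ivl[of "\<lambda>j. prime_zeta (real j * (1 + u)) * almost_prime_zeta (Suc n - j) (1 + u)" 0 n]
        by simp
      also have "\<dots> = real (Suc n) * almost_prime_zeta (Suc n) (1 + u)"
        by (rule almost_prime_zeta_newton[symmetric]) (use u in simp)
      finally have "of_nat (Suc n) * fps_nth A (Suc n) =
         of_nat (Suc n) * complex_of_real (almost_prime_zeta (Suc n) (1 + u))" by simp
      thus ?thesis unfolding Suc by (subst (asm) mult_left_cancel) (auto simp del: of_nat_Suc)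
    qed
  qed
  thus ?thesis by (simp add: A_def L_def q_def)
qed

lemma geo_coeff_fps:
  "Re (fps_nth (geo_fps (of_real (2 powr - (1 + u))) * reg_fps u) i) = geo_coeff u i"
  by (simp add: geo_coeff_def geo_fps_def fps_mult_nth reg_coeff_def flip: of_real_power)

text \<open>Splitting off \<open>u powr - z\<close> puts the whole singularity at
  \<open>u = 0\<close> into powers of \<open>ln u\<close>.\<close>

lemma almost_prime_zeta_expansion:
  assumes u: "u > 0"
  shows "almost_prime_zeta k (1 + u) = (\<Sum>i\<le>k. (- ln u) ^ (k - i) / fact (k - i) * geo_coeff u i)"
proof -
  define H where "H = geo_fps (of_real (2 powr - (1 + u))) * reg_fps u"
  have "almost_prime_zeta k (1 + u) = Re (fps_nth (H * fps_exp (of_real (- ln u))) k)"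
    using almost_prime_zeta_fps[OF u, of k] by (simp add: H_def mult.commute mult.left_commute)
  also have "\<dots> = (\<Sum>i=0..k. Re (fps_nth H i * of_real ((- ln u) ^ (k - i) / fact (k - i))))"
    by (simp add: fps_mult_nth)
  also have "\<dots> = (\<Sum>i=0..k. Re (fps_nth H i) * ((- ln u) ^ (k - i) / fact (k - i)))"
    by (intro sum.cong refl) (simp only: Re_complex_of_real times_complex.sel Im_complex_of_real mult_zero_right diff_zero)
  also have "\<dots> = (\<Sum>i\<le>k. (- ln u) ^ (k - i) / fact (k - i) * geo_coeff u i)"
    unfolding H_def geo_coeff_fps by (simp add: atLeast0AtMost mult.commute)
  finally show ?thesis .
qed

section \<open>Values at \<open>z = 1\<close> and the pole of the zeta function\<close>

lemma reg_fun_real: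
  assumes "u \<ge> 0" "\<bar>x\<bar> < 3"
  shows "reg_fun u (of_real x) = of_real (exp (x * lin_coeff u + tail_val u x))"
  using assms by (simp add: reg_fun_def eval_tail_fps_real flip: exp_of_real)

lemma norm_less_conv_radius_reg:
  assumes "u \<ge> 0" "norm z < 3"
  shows "ereal (norm z) < fps_conv_radius (reg_fps u)"
  using assms(2) by (intro less_le_trans[OF _ reg_fps_conv_radius[OF assms(1)]]) simp

lemma two_powr_le_half:
  assumes "u \<ge> 0"
  shows "2 powr - (1 + u) \<le> (1/2 :: real)"
proof -
  have "2 powr - (1 + u) \<le> 2 powr - (1 :: real)"
    using assms by (intro powr_mono) auto
  thus ?thesis by (simp add: powr_minus)
qed

lemma eval_geo_reg_fps:
  assumes "u \<ge> 0"
  defines "H \<equiv> geo_fps (of_real (2 powr - (1 + u))) * reg_fps u"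
  shows "eval_fps H 1 = of_real (1 / (1 - 2 powr - (1 + u)) * exp (lin_coeff u + tail_val u 1))"
    and "fps_conv_radius H > 1"
proof -
  have q: "norm (complex_of_real (2 powr - (1 + u))) \<le> 1 / 2"
    using two_powr_le_half[OF assms(1)] by simp
  have r: "reg_fun u 1 = of_real (exp (lin_coeff u + tail_val u 1))"
    using reg_fun_real[of u 1] assms(1) by simp
  have 1: "fps_conv_radius (reg_fps u) > 1"
    using norm_less_conv_radius_reg[of u "1::complex"] assms(1) by (simp flip: one_ereal_def)
  show "eval_fps H 1 = of_real (1 / (1 - 2 powr - (1 + u)) * exp (lin_coeff u + tail_val u 1))"
    unfolding H_def using eval_geo_fps[OF q] 1 assms(1) r
    by (subst eval_fps_mult) (auto simp: eval_reg_fps simp flip: one_ereal_def)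
  show "fps_conv_radius H > 1"
    unfolding H_def using eval_geo_fps(2)[OF q] 1
    by (intro less_le_trans[OF _ fps_conv_radius_mult]) auto
qed

lemma sums_geo_coeff:
  assumes "u \<ge> 0"
  shows "geo_coeff u sums (1 / (1 - 2 powr - (1 + u)) * exp (lin_coeff u + tail_val u 1))"
proof -
  have "ereal (norm (1::complex)) < fps_conv_radius (geo_fps (of_real (2 powr - (1 + u))) * reg_fps u)"
    using eval_geo_reg_fps(2)[OF assms] by (simp flip: one_ereal_def)
  from sums_Re[OF sums_eval_fps[OF this]] show ?thesis
    unfolding eval_geo_reg_fps(1)[OF assms] Re_complex_of_real
    by (simp only: power_one mult_1_right geo_coeff_fps)
qed

text \<open>The value chosen for \<open>lin_coeff 0\<close> makes the exponential equal to
  \<open>1/2\<close>, which cancels the factor 2 of the geometric series. This is the source of the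
  leading 1 in the theorem.\<close>

lemma sums_geo_coeff_0: "geo_coeff 0 sums 1"
  using sums_geo_coeff[of 0] by (simp add: lin_coeff_def exp_minus powr_minus)

text \<open>Euler's product, read off by evaluating the generating function of the
  almost prime zeta functions at \<open>1\<close>.\<close>
lemma real_zeta_eq:
  assumes u: "u > 0"
  shows "u * real_zeta (1 + u) * (1 - 2 powr - (1 + u)) = exp (lin_coeff u + tail_val u 1)"
proof -
  define H where "H = geo_fps (of_real (2 powr - (1 + u))) * reg_fps u"
  note H = eval_geo_reg_fps[OF less_imp_le[OF u], folded H_def]
  have lt: "ereal (norm (1::complex)) < fps_conv_radius (fps_exp (complex_of_real (- ln u)) * H)"
    using H(2) by (intro less_le_trans[OF _ fps_conv_radius_mult]) (auto simp flip: one_ereal_def)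
  have "(\<lambda>k. fps_nth (fps_exp (complex_of_real (- ln u)) * H) k * 1 ^ k) sums
        eval_fps (fps_exp (complex_of_real (- ln u)) * H) 1"
    by (rule sums_eval_fps[OF lt])
  also have "eval_fps (fps_exp (complex_of_real (- ln u)) * H) 1 = of_real (1 / u) * eval_fps H 1"
    using H(2) u by (subst eval_fps_mult) (auto simp: exp_minus divide_inverse exp_of_real simp flip: one_ereal_def of_real_minus)
  also have "\<dots> = of_real (1 / u * (1 / (1 - 2 powr - (1 + u)) * exp (lin_coeff u + tail_val u 1)))"
    unfolding H(1) by simp
  finally have "(\<lambda>k. complex_of_real (almost_prime_zeta k (1 + u))) sums
      of_real (1 / u * (1 / (1 - 2 powr - (1 + u)) * exp (lin_coeff u + tail_val u 1)))"
    using almost_prime_zeta_fps[OF u] unfolding H_def by (simp add: mult.assoc)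
  hence "(\<lambda>k. almost_prime_zeta k (1 + u)) sums
      (1 / u * (1 / (1 - 2 powr - (1 + u)) * exp (lin_coeff u + tail_val u 1)))"
    by (subst (asm) sums_of_real_iff)
  moreover have "(\<lambda>k. almost_prime_zeta k (1 + u)) sums real_zeta (1 + u)"
    by (rule sums_almost_prime_zeta) (use u in simp)
  ultimately have "real_zeta (1 + u) = 1 / u * (1 / (1 - 2 powr - (1 + u)) * exp (lin_coeff u + tail_val u 1))"
    by (rule sums_unique2[symmetric])
  moreover have "(1 - 2 powr - (1 + u)) \<noteq> 0"
    using u two_powr_le_half[of u] by auto
  ultimately show ?thesis using u by simp
qed

text \<open>By the mean value theorem the difference quotient is \<open>z powr - (1 + u)\<close> for
  some \<open>z\<close> between \<open>x\<close> and \<open>x + 1\<close>.\<close>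

lemma powr_diff_bounds:
  fixes x u :: real
  assumes "x > 0" "u > 0"
  shows "(x + 1) powr - (1 + u) \<le> (x powr - u - (x + 1) powr - u) / u"
    and "(x powr - u - (x + 1) powr - u) / u \<le> x powr - (1 + u)"
proof -
  have "\<exists>z. x < z \<and> z < x + 1 \<and>
     (x + 1) powr - u - x powr - u = (x + 1 - x) * (- u * z powr (- u - 1))"
    using assms by (intro MVT2) (auto intro!: derivative_eq_intros)
  then obtain z where z: "x < z" "z < x + 1"
    and eq: "(x + 1) powr - u - x powr - u = (x + 1 - x) * (- u * z powr (- u - 1))" by blast
  have e: "- u - 1 = - (1 + u)" by simp
  have eq': "(x powr - u - (x + 1) powr - u) / u = z powr - (1 + u)"
    using eq assms unfolding e by (simp add: field_simps)
  show "(x + 1) powr - (1 + u) \<le> (x powr - u - (x + 1) powr - u) / u"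
    unfolding eq' using z assms by (intro powr_mono2') auto
  show "(x powr - u - (x + 1) powr - u) / u \<le> x powr - (1 + u)"
    unfolding eq' using z assms by (intro powr_mono2') auto
qed

text \<open>Integral test in telescoping form: the series with sum \<open>1 / u\<close> lies between
  the zeta series started at 2 and at 1.\<close>

lemma real_zeta_bounds:
  assumes u: "u > 0"
  shows "1 \<le> u * real_zeta (1 + u)" "u * real_zeta (1 + u) \<le> 1 + u"
proof -
  define f where "f = (\<lambda>n::nat. real n powr - (1 + u))"
  define g where "g = (\<lambda>n::nat. real (Suc n) powr - u)"
  have f: "f sums real_zeta (1 + u)"
    unfolding f_def real_zeta_def by (intro summable_sums summable_powr) (use u in auto)
  \<comment> \<open>Since \<open>f 0 = 0\<close>, the first shift leaves the sum unchanged; the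
    second removes \<open>f 1 = 1\<close>.\<close>
  have f1: "(\<lambda>n. f (Suc n)) sums real_zeta (1 + u)"
    using f sums_Suc_iff[of f "real_zeta (1 + u)"] by (simp add: f_def)
  have f2: "(\<lambda>n. f (Suc (Suc n))) sums (real_zeta (1 + u) - 1)"
    using f1 sums_Suc_iff[of "\<lambda>n. f (Suc n)" "real_zeta (1 + u) - 1"] by (simp add: f_def)
  have "g \<longlonglongrightarrow> 0"
    unfolding g_def using LIMSEQ_Suc[OF tendsto_neg_powr[OF _ filterlim_real_sequentially, of "- u"]] u by simp
  from sums_divide[OF telescope_sums'[OF this], of u]
  have g: "(\<lambda>n. (g n - g (Suc n)) / u) sums (1 / u)" by (simp add: g_def)
  have e: "real (Suc n) + 1 = real (Suc (Suc n))" for n by simp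
  have "1 / u \<le> real_zeta (1 + u)"
  proof (rule sums_le[OF _ g f1])
    show "(g n - g (Suc n)) / u \<le> f (Suc n)" for n
      using powr_diff_bounds(2)[of "real (Suc n)" u, unfolded e] u unfolding f_def g_def by linarith
  qed
  moreover have "real_zeta (1 + u) - 1 \<le> 1 / u"
  proof (rule sums_le[OF _ f2 g])
    show "f (Suc (Suc n)) \<le> (g n - g (Suc n)) / u" for n
      using powr_diff_bounds(1)[of "real (Suc n)" u, unfolded e] u unfolding f_def g_def by linarith
  qed
  ultimately show "1 \<le> u * real_zeta (1 + u)" "u * real_zeta (1 + u) \<le> 1 + u"
    using u by (auto simp: field_simps)
qed

section \<open>Uniform bounds for the regular factor\<close>

text \<open>The radius \<open>5/2\<close> lies below 3, so a geometric majorant of ratio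
  \<open>5/6\<close> serves for all \<open>u\<close>; its sum is 6 times the constant.\<close>

lemma eval_tail_fps_bounds:
  obtains K where "K > 0"
    "\<And>u z. u \<ge> 0 \<Longrightarrow> norm z \<le> 5/2 \<Longrightarrow> norm (eval_fps (tail_fps u) z) \<le> K"
    "\<And>u z. u \<ge> 0 \<Longrightarrow> norm z \<le> 5/2 \<Longrightarrow> norm (eval_fps (tail_fps u) z - eval_fps (tail_fps 0) z) \<le> K * u"
proof -
  obtain K where K: "K > 0" "\<And>u m. u \<ge> 0 \<Longrightarrow> \<bar>tail_coeff u m\<bar> \<le> K / 3 ^ m"
    "\<And>u m. u \<ge> 0 \<Longrightarrow> \<bar>tail_coeff u m - tail_coeff 0 m\<bar> \<le> K * u / 3 ^ m"
    using tail_coeff_bounds by metis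
  have geo: "(\<lambda>m. c * (5/6) ^ m) sums (6 * c)" for c :: real
    using sums_mult[OF geometric_sums[of "5/6::real"], of c] by (simp add: mult.commute)
  have pw: "x * norm z ^ m \<le> c * (5/6) ^ m" if "0 \<le> x" "x \<le> c / 3 ^ m" "norm z \<le> 5/2" for x c m and z :: complex
  proof -
    have "x * norm z ^ m \<le> (c / 3 ^ m) * (5/2) ^ m"
      using that by (intro mult_mono power_mono) auto
    also have "\<dots> = c * (5/6) ^ m" by (simp add: power_divide flip: power_mult_distrib)
    finally show ?thesis .
  qed
  show ?thesis
  proof
    show "6 * K > 0" using K by simp
    fix u :: real and z :: complex assume u: "u \<ge> 0" and z: "norm z \<le> 5/2"
    have z3: "norm z < 3" using z by simp
    have "norm (\<Sum>m. of_real (tail_coeff u m) * z ^ m) \<le> (\<Sum>m. K * (5/6) ^ m)"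
      using K(2)[OF u] z by (intro norm_suminf_le sums_summable[OF geo]) (auto simp: norm_mult norm_power intro!: pw)
    thus "norm (eval_fps (tail_fps u) z) \<le> 6 * K"
      using sums_unique[OF geo[of K]] by (simp add: eval_fps_def tail_fps_def)
    have "eval_fps (tail_fps u) z - eval_fps (tail_fps 0) z =
       (\<Sum>m. of_real (tail_coeff u m) * z ^ m - of_real (tail_coeff 0 m) * z ^ m)"
      using summable_tail_coeff[OF u z3] summable_tail_coeff[OF order.refl z3]
      by (simp add: eval_fps_def tail_fps_def suminf_diff)
    also have "\<dots> = (\<Sum>m. of_real (tail_coeff u m - tail_coeff 0 m) * z ^ m)"
      by (simp add: algebra_simps)
    also have "norm \<dots> \<le> (\<Sum>m. (K * u) * (5/6) ^ m)"
    proof (intro norm_suminf_le sums_summable[OF geo])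
      fix m
      show "norm (of_real (tail_coeff u m - tail_coeff 0 m) * z ^ m) \<le> (K * u) * (5/6) ^ m"
        unfolding norm_mult norm_power norm_of_real using K(3)[OF u] z by (intro pw) auto
    qed
    also have "\<dots> = 6 * K * u" using sums_unique[OF geo[of "K * u"]] by simp
    finally show "norm (eval_fps (tail_fps u) z - eval_fps (tail_fps 0) z) \<le> 6 * K * u" .
  qed
qed

lemma ln2_le_1: "ln (2::real) \<le> 1"
  using ln_le_minus_one[of "2::real"] by simp

text \<open>The sum of logarithms is \<open>ln (2 - 2 powr - u)\<close>, and
  \<open>2 powr - u\<close> lies between \<open>1 - u\<close> and 1.\<close>

lemma ln_one_minus_two_powr_bounds:
  assumes "u \<ge> (0::real)"
  shows "0 \<le> ln (1 - 2 powr - (1 + u)) + ln 2" "ln (1 - 2 powr - (1 + u)) + ln 2 \<le> u"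
proof -
  have q: "2 powr - (1 + u) \<le> (1/2::real)" using two_powr_le_half[OF assms] .
  have q2: "2 powr - (1 + u) * 2 = (2 :: real) powr - u"
    using powr_add[of "2::real" "- (1 + u)" 1] by simp
  have eq: "ln (1 - 2 powr - (1 + u)) + ln 2 = ln (2 - 2 powr - u)"
    using q ln_mult_pos[of "1 - 2 powr - (1 + u)" 2] unfolding left_diff_distrib q2 by simp
  have a: "2 powr - u \<le> (1::real)"
    using assms by (simp add: powr_def)
  have "u * ln 2 \<le> u * 1" using ln2_le_1 assms by (intro mult_left_mono) auto
  hence b: "2 powr - u \<ge> 1 - u"
    using exp_ge_add_one_self[of "- (u * ln 2)"] unfolding powr_def by simp
  show "0 \<le> ln (1 - 2 powr - (1 + u)) + ln 2"
    unfolding eq using a by (intro ln_ge_zero) auto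
  have "ln (2 - 2 powr - u) \<le> (2 - 2 powr - u) - 1"
    using a by (intro ln_le_minus_one) auto
  thus "ln (1 - 2 powr - (1 + u)) + ln 2 \<le> u" unfolding eq using b by simp
qed

text \<open>Logarithms of \<open>real_zeta_eq\<close> express \<open>lin_coeff u\<close> through
  \<open>ln (u * real_zeta (1 + u))\<close>, the Euler factor at 2 and \<open>tail_val u 1\<close>.
  Each is within \<open>O(u)\<close> of its limit, and \<open>lin_coeff 0\<close> combines these
  limits; the sum over primes need not be estimated directly.\<close>

lemma lin_coeff_bound:
  obtains C where "C > 0" "\<And>u. 0 \<le> u \<Longrightarrow> \<bar>lin_coeff u - lin_coeff 0\<bar> \<le> C * u"
proof -
  obtain K where K: "K > 0"
    "\<And>u z. u \<ge> 0 \<Longrightarrow> norm z \<le> 5/2 \<Longrightarrow> norm (eval_fps (tail_fps u) z - eval_fps (tail_fps 0) z) \<le> K * u"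
    using eval_tail_fps_bounds by metis
  show ?thesis
  proof
    show "K + 2 > 0" using K by simp
    fix u :: real assume "0 \<le> u"
    show "\<bar>lin_coeff u - lin_coeff 0\<bar> \<le> (K + 2) * u"
    proof (cases "u = 0")
      case False
      hence u: "u > 0" using \<open>0 \<le> u\<close> by simp
      have t: "\<bar>tail_val u 1 - tail_val 0 1\<bar> \<le> K * u"
        using K(2)[of u "of_real 1"] u unfolding eval_tail_fps_real(1)[OF less_imp_le[OF u], of 1, simplified]
        by (simp add: eval_tail_fps_real(1)[of _ 1, simplified] flip: of_real_diff)
      have z: "1 \<le> u * real_zeta (1 + u)" "u * real_zeta (1 + u) \<le> 1 + u"
        using real_zeta_bounds[OF u] .
      have "2 powr - (1 + u) \<le> (1/2::real)" using two_powr_le_half u by simp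
      hence "ln (u * real_zeta (1 + u)) + ln (1 - 2 powr - (1 + u)) = lin_coeff u + tail_val u 1"
        using real_zeta_eq[OF u] z ln_mult_pos[of "u * real_zeta (1 + u)" "1 - 2 powr - (1 + u)"] by simp
      moreover have "0 \<le> ln (u * real_zeta (1 + u))" using z by (intro ln_ge_zero) auto
      moreover have "ln (u * real_zeta (1 + u)) \<le> u"
        using ln_le_minus_one[of "u * real_zeta (1 + u)"] z by linarith
      moreover have "lin_coeff 0 = - ln 2 - tail_val 0 1" by (simp add: lin_coeff_def)
      ultimately have "\<bar>lin_coeff u - lin_coeff 0\<bar> \<le> K * u + 2 * u"
        using ln_one_minus_two_powr_bounds[of u] u t by linarith
      thus ?thesis by (simp add: algebra_simps)
    qed simp
  qed
qed

lemma norm_exp_diff_le: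
  fixes a b :: complex
  assumes "norm a \<le> R" "norm b \<le> R"
  shows "norm (exp a - exp b) \<le> exp R * norm (a - b)"
proof (rule field_differentiable_bound[of "cball 0 R" exp exp])
  fix z :: complex assume "z \<in> cball 0 R"
  thus "norm (exp z) \<le> exp R" using norm_exp[of z] by (auto intro: order.trans)
qed (use assms in \<open>auto intro!: derivative_eq_intros\<close>)

text \<open>For \<open>u\<close> at most 1 the exponents stay in a fixed disc, on which the
  exponential is bounded and Lipschitz.\<close>

lemma reg_fun_bounds:
  obtains C where "C > 0"
    "\<And>u z. 0 \<le> u \<Longrightarrow> u \<le> 1 \<Longrightarrow> norm z \<le> 5/2 \<Longrightarrow> norm (reg_fun u z) \<le> C"
    "\<And>u z. 0 \<le> u \<Longrightarrow> u \<le> 1 \<Longrightarrow> norm z \<le> 5/2 \<Longrightarrow> norm (reg_fun u z - reg_fun 0 z) \<le> C * u"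
proof -
  obtain K where K: "K > 0"
    "\<And>u z. u \<ge> 0 \<Longrightarrow> norm z \<le> 5/2 \<Longrightarrow> norm (eval_fps (tail_fps u) z) \<le> K"
    "\<And>u z. u \<ge> 0 \<Longrightarrow> norm z \<le> 5/2 \<Longrightarrow> norm (eval_fps (tail_fps u) z - eval_fps (tail_fps 0) z) \<le> K * u"
    using eval_tail_fps_bounds by metis
  obtain B where B: "B > 0" "\<And>u. 0 \<le> u \<Longrightarrow> \<bar>lin_coeff u - lin_coeff 0\<bar> \<le> B * u"
    using lin_coeff_bound by metis
  define X where "X = (\<lambda>u z. z * complex_of_real (lin_coeff u) + eval_fps (tail_fps u) z)"
  define R where "R = 5/2 * (\<bar>lin_coeff 0\<bar> + B) + K"
  define M where "M = 5/2 * B + K"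
  have X: "norm (X u z) \<le> R" "norm (X u z - X 0 z) \<le> M * u" if u: "0 \<le> u" "u \<le> 1" and z: "norm z \<le> 5/2" for u z
  proof -
    have "B * u \<le> B * 1" using B u by (intro mult_left_mono) auto
    hence "\<bar>lin_coeff u\<bar> \<le> \<bar>lin_coeff 0\<bar> + B" using B(2)[OF u(1)] by linarith
    hence "norm (z * complex_of_real (lin_coeff u)) \<le> 5/2 * (\<bar>lin_coeff 0\<bar> + B)"
      unfolding norm_mult norm_of_real using z B by (intro mult_mono) auto
    thus "norm (X u z) \<le> R"
      unfolding X_def R_def by (intro norm_triangle_mono K u z)
    have "X u z - X 0 z = z * of_real (lin_coeff u - lin_coeff 0) + (eval_fps (tail_fps u) z - eval_fps (tail_fps 0) z)"
      by (simp add: X_def algebra_simps)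
    also have "norm \<dots> \<le> 5/2 * (B * u) + K * u"
    proof (intro norm_triangle_mono K u z)
      show "norm (z * of_real (lin_coeff u - lin_coeff 0)) \<le> 5/2 * (B * u)"
        unfolding norm_mult norm_of_real using z B(2)[OF u(1)] by (intro mult_mono) auto
    qed
    finally show "norm (X u z - X 0 z) \<le> M * u" by (simp add: M_def algebra_simps)
  qed
  have M0: "M > 0" using B K by (simp add: M_def)
  show ?thesis
  proof
    show "exp R * (1 + M) > 0" using M0 by simp
    fix u :: real and z :: complex assume u: "0 \<le> u" "u \<le> 1" and z: "norm z \<le> 5/2"
    have r: "reg_fun v z = exp (X v z)" for v by (simp add: reg_fun_def X_def)
    have "norm (exp (X u z)) \<le> exp R" using X(1)[OF u z] norm_exp[of "X u z"] by (auto intro: order.trans)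
    also have "\<dots> \<le> exp R * (1 + M)" using M0 by simp
    finally show "norm (reg_fun u z) \<le> exp R * (1 + M)" by (simp add: r)
    have "norm (exp (X u z) - exp (X 0 z)) \<le> exp R * norm (X u z - X 0 z)"
      using X(1)[OF u z] X(1)[of 0 z] z by (intro norm_exp_diff_le) auto
    also have "\<dots> \<le> exp R * (M * u)" by (intro mult_left_mono X u z) auto
    also have "\<dots> \<le> exp R * (1 + M) * u" using u by (simp add: algebra_simps)
    finally show "norm (reg_fun u z - reg_fun 0 z) \<le> exp R * (1 + M) * u" by (simp add: r)
  qed
qed

lemma fps_nth_cauchy_bound:
  assumes "f has_fps_expansion F" "f holomorphic_on ball 0 R" "0 < r" "r < R"
    and "\<And>z. norm z = r \<Longrightarrow> norm (f z) \<le> B"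
  shows "norm (fps_nth F n) \<le> B / r ^ n"
proof -
  have "norm ((deriv ^^ n) f 0) \<le> fact n * B / r ^ n"
  proof (rule Cauchy_inequality)
    show "f holomorphic_on ball 0 r" using assms(2) by (rule holomorphic_on_subset) (use assms in auto)
    show "continuous_on (cball 0 r) f"
      by (intro holomorphic_on_imp_continuous_on holomorphic_on_subset[OF assms(2)]) (use assms in auto)
  qed (use assms in auto)
  thus ?thesis unfolding fps_nth_fps_expansion[OF assms(1)]
    by (simp add: norm_divide field_simps)
qed

text \<open>Cauchy's inequality on the circle of radius \<open>5/2\<close>, for
  \<open>reg_fun u\<close> and for its difference from \<open>reg_fun 0\<close>. The rate
  \<open>2/5\<close> beats the \<open>1/2\<close> of the geometric factor.\<close>

lemma reg_coeff_bounds: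
  obtains C where "C > 0"
    "\<And>u b. 0 \<le> u \<Longrightarrow> u \<le> 1 \<Longrightarrow> \<bar>reg_coeff u b\<bar> \<le> C * (2/5) ^ b"
    "\<And>u b. 0 \<le> u \<Longrightarrow> u \<le> 1 \<Longrightarrow> \<bar>reg_coeff u b - reg_coeff 0 b\<bar> \<le> C * u * (2/5) ^ b"
proof -
  obtain C where C: "C > 0"
    "\<And>u z. 0 \<le> u \<Longrightarrow> u \<le> 1 \<Longrightarrow> norm z \<le> 5/2 \<Longrightarrow> norm (reg_fun u z) \<le> C"
    "\<And>u z. 0 \<le> u \<Longrightarrow> u \<le> 1 \<Longrightarrow> norm z \<le> 5/2 \<Longrightarrow> norm (reg_fun u z - reg_fun 0 z) \<le> C * u"
    using reg_fun_bounds by metis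
  have pw: "x / (5/2) ^ b = x * (2/5) ^ b" for x :: real and b by (simp add: power_divide)
  show ?thesis
  proof
    show "C > 0" by fact
    fix u :: real and b assume u: "0 \<le> u" "u \<le> 1"
    have "norm (fps_nth (reg_fps u) b) \<le> C / (5/2) ^ b"
      by (rule fps_nth_cauchy_bound[OF reg_fun_expansion reg_fun_holomorphic]) (use u C in auto)
    thus "\<bar>reg_coeff u b\<bar> \<le> C * (2/5) ^ b"
      unfolding reg_coeff_def pw using abs_Re_le_cmod order.trans by blast
    have "norm (fps_nth (reg_fps u - reg_fps 0) b) \<le> (C * u) / (5/2) ^ b"
      by (rule fps_nth_cauchy_bound[of "\<lambda>z. reg_fun u z - reg_fun 0 z" _ 3])
         (use u C in \<open>auto intro!: has_fps_expansion_diff reg_fun_expansion holomorphic_on_diff reg_fun_holomorphic\<close>)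
    thus "\<bar>reg_coeff u b - reg_coeff 0 b\<bar> \<le> C * u * (2/5) ^ b"
      unfolding reg_coeff_def pw using abs_Re_le_cmod[of "fps_nth (reg_fps u - reg_fps 0) b"] by simp
  qed
qed

section \<open>Identification of \<open>d_const\<close>\<close>

lemma d_factor_pos:
  assumes "p > 2"
  shows "d_factor p > 0"
proof -
  have "real p > 2" using assms by simp
  thus ?thesis unfolding d_factor_def by (intro mult_pos_pos) auto
qed

text \<open>Two logarithm series are combined. The term at \<open>m = 1\<close> cancels, and the one
  at \<open>m = 0\<close> is 0 because division by 0 gives 0.\<close>

lemma ln_d_factor_sums:
  assumes "p > 2"
  shows "(\<lambda>m. (2 ^ m - 2) / real m * real p powr - real m) sums ln (d_factor p)"
proof -
  have p: "real p > 2" using assms by simp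
  have 1: "(\<lambda>n. - ((2 / real p) ^ n) / real n) sums ln (1 - 2 / real p)"
    using ln_series'[of "- (2 / real p)"] p by simp
  have 2: "(\<lambda>n. - ((1 / real p) ^ n) / real n) sums ln (1 - 1 / real p)"
    using ln_series'[of "- (1 / real p)"] p by simp
  have "(\<lambda>n. 2 * (- ((1 / real p) ^ n) / real n) - (- ((2 / real p) ^ n) / real n)) sums
      (2 * ln (1 - 1 / real p) - ln (1 - 2 / real p))"
    by (intro sums_diff sums_mult 1 2)
  also have "2 * ln (1 - 1 / real p) - ln (1 - 2 / real p) = ln (d_factor p)"
    using p unfolding d_factor_def by (subst ln_mult) (auto simp: ln_inverse ln_realpow)
  also have "(\<lambda>n. 2 * (- ((1 / real p) ^ n) / real n) - (- ((2 / real p) ^ n) / real n)) =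
      (\<lambda>m. (2 ^ m - 2) / real m * real p powr - real m)"
  proof
    fix m :: nat
    have pw: "real p powr - real m = 1 / real p ^ m"
      using p by (simp add: powr_minus powr_realpow divide_inverse)
    show "2 * (- ((1 / real p) ^ m) / real m) - (- ((2 / real p) ^ m) / real m) =
        (2 ^ m - 2) / real m * real p powr - real m"
      unfolding pw by (simp add: power_divide diff_divide_distrib mult.commute)
  qed
  finally show ?thesis .
qed

text \<open>The logarithm of the product is a double sum over \<open>p\<close> and \<open>m\<close>
  with nonnegative terms, so the order of summation may be exchanged; summing over \<open>p\<close>
  first gives the tail values.\<close>

lemma d_const_eq: "d_const = 1 / 4 * exp (tail_val 0 2 - 2 * tail_val 0 1)"
proof -
  define S where "S = tail_val 0 2 - 2 * tail_val 0 1"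
  define Q where "Q = {p::nat. prime p \<and> p > 2}"
  define F where "F = (\<lambda>(m::nat, p::nat). (2 ^ m - 2) / real m * real p powr - real m)"
  have pos: "(2 ^ m - 2) / real m \<ge> 0" if "m \<ge> 2" for m :: nat
    using that power_increasing[of 1 m "2::real"] by (intro divide_nonneg_nonneg) auto
  have "(\<lambda>m. tail_coeff 0 m * 2 ^ m - 2 * (tail_coeff 0 m * 1 ^ m)) sums S"
    unfolding S_def by (intro sums_diff sums_mult eval_tail_fps_real(2)) auto
  hence "(\<lambda>m. (2 ^ m - 2) * tail_coeff 0 m) sums S" by (simp add: algebra_simps)
  moreover have "(2 ^ m - 2) * tail_coeff 0 m \<ge> 0" for m
  proof (cases "m \<ge> 2")
    case True
    thus ?thesis using power_increasing[of 1 m "2::real"] by (intro mult_nonneg_nonneg tail_coeff_nonneg) auto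
  qed (simp add: tail_coeff_def)
  ultimately have "((\<lambda>m. (2 ^ m - 2) * tail_coeff 0 m) has_sum S) UNIV"
    by (rule sums_nonneg_imp_has_sum)
  hence outer: "((\<lambda>m. (2 ^ m - 2) / real m * odd_prime_zeta (real m)) has_sum S) {2..}"
    by (rule has_sum_cong_neutral[THEN iffD1, rotated -1]) (auto simp: tail_coeff_def)
  have inner: "((\<lambda>p. F (m, p)) has_sum ((2 ^ m - 2) / real m * odd_prime_zeta (real m))) Q"
    if "m \<in> {2..}" for m
    unfolding F_def odd_prime_zeta_def Q_def[symmetric] split using that
    by (intro has_sum_cmult_right has_sum_infsum summable_on_powr) auto
  have "F summable_on (SIGMA m:{2..}. Q)"
  proof (rule summable_on_SigmaI)
    show "F (m, p) \<ge> 0" if "m \<in> {2..}" for m p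
      unfolding F_def split using that pos by (intro mult_nonneg_nonneg) auto
  qed (use inner has_sum_imp_summable[OF outer] in blast)+
  hence "(F has_sum S) ({2..} \<times> Q)"
    using inner outer by (intro has_sum_SigmaI[where g = "\<lambda>m. (2 ^ m - 2) / real m * odd_prime_zeta (real m)"]) blast+
  hence "((\<lambda>(p, m). F (m, p)) has_sum S) (Q \<times> {2..})"
    by (subst (asm) has_sum_swap)
  hence "((\<lambda>p. ln (d_factor p)) has_sum S) Q"
  proof (rule has_sum_SigmaD)
    fix p assume "p \<in> Q"
    hence "(\<lambda>m. F (m, p)) sums ln (d_factor p)"
      using ln_d_factor_sums[of p] by (simp add: Q_def F_def)
    moreover have "F (m, p) \<ge> 0" for m
    proof (cases "m \<ge> 2")
      case False
      hence "m = 0 \<or> m = 1" by auto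
      thus ?thesis by (auto simp: F_def)
    next
      case True
      thus ?thesis unfolding F_def split using pos by (intro mult_nonneg_nonneg) auto
    qed
    ultimately have "((\<lambda>m. F (m, p)) has_sum ln (d_factor p)) UNIV"
      by (rule sums_nonneg_imp_has_sum)
    hence "((\<lambda>m. F (m, p)) has_sum ln (d_factor p)) {2..}"
    proof (rule has_sum_cong_neutral[THEN iffD1, rotated -1])
      fix m assume "m \<in> UNIV - {2::nat..}"
      hence "m = 0 \<or> m = 1" by auto
      thus "F (m, p) = 0" by (auto simp: F_def)
    qed auto
    thus "((\<lambda>m. case (p, m) of (p, m) \<Rightarrow> F (m, p)) has_sum ln (d_factor p)) {2..}" by simp
  qed
  hence "((\<lambda>p. ln (if prime p \<and> p > 2 then d_factor p else 1)) has_sum S) UNIV"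
    by (rule has_sum_cong_neutral[THEN iffD1, rotated -1]) (auto simp: Q_def)
  hence "S = (\<Sum>p. ln (if prime p \<and> p > 2 then d_factor p else 1))"
    by (intro sums_unique has_sum_imp_sums)
  moreover have "(\<Prod>p. if prime p \<and> p > 2 then d_factor p else 1) =
      exp (\<Sum>p. ln (if prime p \<and> p > 2 then d_factor p else 1))"
    by (intro prodinf_exp_real abs_convergent_prod_imp_convergent_prod abs_convergent_prod_d_factor)
       (auto intro: d_factor_pos)
  ultimately show ?thesis by (simp add: d_const_def S_def)
qed

text \<open>The pole 2 of the geometric factor at \<open>u = 0\<close> lies inside the disc of
  radius 3, and \<open>d_const\<close> is the value of \<open>reg_fun 0\<close> there. The
  \<open>1/4\<close> in \<open>d_const\<close> comes from the \<open>- ln 2\<close> in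
  \<open>lin_coeff 0\<close>.\<close>

lemma reg_coeff_sums_d_const: "(\<lambda>b. reg_coeff 0 b * 2 ^ b) sums d_const"
proof -
  have "ereal (norm (2::complex)) < fps_conv_radius (reg_fps 0)"
    by (rule norm_less_conv_radius_reg) auto
  hence "(\<lambda>b. fps_nth (reg_fps 0) b * 2 ^ b) sums eval_fps (reg_fps 0) 2"
    by (rule sums_eval_fps)
  also have "eval_fps (reg_fps 0) 2 = of_real (exp (2 * lin_coeff 0 + tail_val 0 2))"
    using reg_fun_real[of 0 2] by (simp add: eval_reg_fps)
  also have "2 * lin_coeff 0 + tail_val 0 2 = tail_val 0 2 - 2 * tail_val 0 1 - ln 4"
    using ln_realpow[of "2::real" 2] by (simp add: lin_coeff_def)
  also have "exp \<dots> = d_const" by (simp add: d_const_eq exp_diff)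
  finally have "(\<lambda>b. Re (fps_nth (reg_fps 0) b * 2 ^ b)) sums Re (of_real d_const)"
    by (rule sums_Re)
  moreover have "Re (fps_nth (reg_fps 0) b * 2 ^ b) = reg_coeff 0 b * 2 ^ b" for b
  proof -
    have "(2 :: complex) ^ b = of_real (2 ^ b)" by simp
    thus ?thesis by (simp only: reg_coeff_def times_complex.sel Re_complex_of_real Im_complex_of_real mult_zero_right diff_zero)
  qed
  ultimately show ?thesis by simp
qed

section \<open>First order expansion of the coefficients\<close>

lemma exp_minus_bounds:
  fixes x :: real
  assumes "x \<ge> 0"
  shows "\<bar>exp (- x) - 1 + x\<bar> \<le> x" "\<bar>exp (- x) - 1 + x\<bar> \<le> x\<^sup>2"
proof -
  have lo: "exp (- x) \<ge> 1 - x" using exp_ge_add_one_self[of "- x"] by simp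
  have "exp (- x) \<le> 1" using assms by simp
  with lo show "\<bar>exp (- x) - 1 + x\<bar> \<le> x" by linarith
  \<comment> \<open>The product equals \<open>1 + x ^ 3\<close>.\<close>
  have "(1 - x + x\<^sup>2) * (1 + x) \<ge> 1"
    using assms by (simp add: algebra_simps power2_eq_square)
  moreover have "1 - x + x\<^sup>2 \<ge> 0"
    using zero_le_power2[of "x - 1/2"] by (simp add: power2_eq_square algebra_simps)
  ultimately have "1 \<le> (1 - x + x\<^sup>2) * exp x"
    using exp_ge_add_one_self[of x] by (smt (verit) mult_left_mono)
  hence "exp (- x) \<le> 1 - x + x\<^sup>2" by (simp add: exp_minus field_simps)
  with lo show "\<bar>exp (- x) - 1 + x\<bar> \<le> x\<^sup>2" by linarith
qed

text \<open>Relative to \<open>(1/2) ^ i\<close> the terms are powers of \<open>4/5\<close>, whose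
  sum is at most 5.\<close>

lemma half_two_fifths_convolution:
  "(\<Sum>a=0..i. (1/2) ^ a * (2/5) ^ (i - a)) \<le> 5 * (1/2 :: real) ^ i"
proof -
  have "(\<Sum>a=0..i. (1/2) ^ a * (2/5) ^ (i - a)) = (\<Sum>a=0..i. (1/2 :: real) ^ i * (4/5) ^ (i - a))"
  proof (intro sum.cong refl)
    fix a assume "a \<in> {0..i}"
    hence "(1/2 :: real) ^ i = (1/2) ^ a * (1/2) ^ (i - a)" by (simp flip: power_add)
    thus "(1/2) ^ a * (2/5) ^ (i - a) = (1/2 :: real) ^ i * (4/5) ^ (i - a)"
      by (simp add: mult.assoc flip: power_mult_distrib)
  qed
  also have "\<dots> = (1/2) ^ i * (\<Sum>a=0..i. (4/5) ^ (i - a))"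
    by (simp add: sum_distrib_left)
  also have "(\<Sum>a=0..i. (4/5 :: real) ^ (i - a)) = (\<Sum>b\<le>i. (4/5) ^ b)"
    by (rule sum.reindex_bij_witness[of _ "\<lambda>b. i - b" "\<lambda>b. i - b"]) auto
  also have "(\<Sum>b\<le>i. (4/5 :: real) ^ b) \<le> 5"
    using sum_le_suminf[OF summable_geometric, of "4/5 :: real" "{..i}"] by (simp add: suminf_geometric)
  finally show ?thesis by (simp add: mult.commute)
qed

lemma geo_coeff_bound:
  obtains C where "C > 0" "\<And>u i. 0 \<le> u \<Longrightarrow> u \<le> 1 \<Longrightarrow> \<bar>geo_coeff u i\<bar> \<le> C * (1/2) ^ i"
proof -
  obtain C where C: "C > 0" "\<And>u b. 0 \<le> u \<Longrightarrow> u \<le> 1 \<Longrightarrow> \<bar>reg_coeff u b\<bar> \<le> C * (2/5) ^ b"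
    using reg_coeff_bounds by metis
  show ?thesis
  proof
    show "C * 5 > 0" using C by simp
    fix u :: real and i assume u: "0 \<le> u" "u \<le> 1"
    have "\<bar>geo_coeff u i\<bar> \<le> (\<Sum>a=0..i. \<bar>(2 powr - (1 + u)) ^ a * reg_coeff u (i - a)\<bar>)"
      unfolding geo_coeff_def by (rule sum_abs)
    also have "\<dots> \<le> (\<Sum>a=0..i. (1/2) ^ a * (C * (2/5) ^ (i - a)))"
      unfolding abs_mult using two_powr_le_half[OF u(1)] u C
      by (intro sum_mono mult_mono) (auto intro!: power_mono)
    also have "\<dots> = C * (\<Sum>a=0..i. (1/2) ^ a * (2/5) ^ (i - a))"
      by (simp add: sum_distrib_left mult.left_commute)
    also have "\<dots> \<le> C * (5 * (1/2) ^ i)"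
      using C half_two_fifths_convolution by (intro mult_left_mono) auto
    finally show "\<bar>geo_coeff u i\<bar> \<le> C * 5 * (1/2) ^ i" by simp
  qed
qed

text \<open>The difference is the series of \<open>min i b * (reg_coeff 0 b * 2 ^ b)\<close> over
  all \<open>b\<close>. Up to a constant it is dominated by \<open>(b + 1) * (4/5) ^ b\<close>,
  which has sum 25 whatever \<open>i\<close> is.\<close>

lemma d_const_partial_sum:
  obtains C where "C > 0"
    "\<And>i. \<bar>real i * d_const - (\<Sum>b=0..i. real (i - b) * (reg_coeff 0 b * 2 ^ b))\<bar> \<le> C"
proof -
  obtain C where C: "C > 0" "\<And>u b. 0 \<le> u \<Longrightarrow> u \<le> 1 \<Longrightarrow> \<bar>reg_coeff u b\<bar> \<le> C * (2/5) ^ b"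
    using reg_coeff_bounds by metis
  have s: "(\<lambda>b. C * (real (Suc b) * (4/5) ^ b)) sums (C * 25)"
    using sums_mult[OF geometric_deriv_sums[of "4/5 :: real"], of C] by (simp add: power2_eq_square)
  show ?thesis
  proof
    show "C * 25 > 0" using C by simp
    fix i
    define r where "r = (\<lambda>b. reg_coeff 0 b * 2 ^ b)"
    have "(\<lambda>b. if b \<in> {0..i} then real (i - b) * r b else 0) sums (\<Sum>b=0..i. real (i - b) * r b)"
      by (rule sums_If_finite_set) simp
    moreover have "(\<lambda>b. real i * r b) sums (real i * d_const)"
      unfolding r_def by (intro sums_mult reg_coeff_sums_d_const)
    ultimately have "(\<lambda>b. real i * r b - (if b \<in> {0..i} then real (i - b) * r b else 0)) sums
        (real i * d_const - (\<Sum>b=0..i. real (i - b) * r b))"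
      by (intro sums_diff)
    also have "(\<lambda>b. real i * r b - (if b \<in> {0..i} then real (i - b) * r b else 0)) = (\<lambda>b. real (min i b) * r b)"
      by (auto simp: fun_eq_iff of_nat_diff algebra_simps min_def)
    finally have m: "(\<lambda>b. real (min i b) * r b) sums (real i * d_const - (\<Sum>b=0..i. real (i - b) * r b))" .
    have "norm (\<Sum>b. real (min i b) * r b) \<le> (\<Sum>b. C * (real (Suc b) * (4/5) ^ b))"
    proof (intro norm_suminf_le sums_summable[OF s])
      fix b
      have "\<bar>r b\<bar> \<le> C * (2/5) ^ b * 2 ^ b"
        unfolding r_def abs_mult using C(2)[of 0 b] by (intro mult_mono) auto
      also have "\<dots> = C * (4/5) ^ b" by (simp add: mult.assoc flip: power_mult_distrib)
      finally have "real (min i b) * \<bar>r b\<bar> \<le> real (Suc b) * (C * (4/5) ^ b)"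
        by (intro mult_mono) auto
      thus "norm (real (min i b) * r b) \<le> C * (real (Suc b) * (4/5) ^ b)"
        by (simp add: abs_mult mult_ac)
    qed
    thus "\<bar>real i * d_const - (\<Sum>b=0..i. real (i - b) * (reg_coeff 0 b * 2 ^ b))\<bar> \<le> C * 25"
      using sums_unique[OF m] sums_unique[OF s] by (simp add: r_def)
  qed
qed

text \<open>Two forms of the error are needed because \<open>i * u\<close> may be large: after integration the
  linear one is weaker by a geometric factor for large \<open>k - i\<close>, the quadratic one by a factor
  \<open>k\<close> for small \<open>k - i\<close>.\<close>
lemma geo_coeff_expansion:
  obtains C where "C > 0"
    "\<And>u i. 0 \<le> u \<Longrightarrow> u \<le> 1 \<Longrightarrow>
       \<bar>geo_coeff u i - geo_coeff 0 i + ln 2 * d_const * real i * (1/2) ^ i * u\<bar>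
         \<le> C * (1/2) ^ i * (u + real i * u)"
    "\<And>u i. 0 \<le> u \<Longrightarrow> u \<le> 1 \<Longrightarrow>
       \<bar>geo_coeff u i - geo_coeff 0 i + ln 2 * d_const * real i * (1/2) ^ i * u\<bar>
         \<le> C * (1/2) ^ i * (u + (real i * u)\<^sup>2)"
proof -
  obtain C where C: "C > 0"
    "\<And>u b. 0 \<le> u \<Longrightarrow> u \<le> 1 \<Longrightarrow> \<bar>reg_coeff u b\<bar> \<le> C * (2/5) ^ b"
    "\<And>u b. 0 \<le> u \<Longrightarrow> u \<le> 1 \<Longrightarrow> \<bar>reg_coeff u b - reg_coeff 0 b\<bar> \<le> C * u * (2/5) ^ b"
    using reg_coeff_bounds by metis
  obtain D where D: "D > 0"
    "\<And>i. \<bar>real i * d_const - (\<Sum>b=0..i. real (i - b) * (reg_coeff 0 b * 2 ^ b))\<bar> \<le> D"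
    using d_const_partial_sum by metis
  \<comment> \<open>Both bounds are instances of one estimate, where \<open>y\<close> is any bound
    for the remainder of \<open>exp (- x)\<close> on the range that occurs.\<close>
  have main: "\<bar>geo_coeff u i - geo_coeff 0 i + ln 2 * d_const * real i * (1/2) ^ i * u\<bar>
         \<le> (5 * C + D) * (1/2) ^ i * (u + y)"
    if u: "0 \<le> u" "u \<le> 1" and y0: "y \<ge> 0"
      and y: "\<And>x. 0 \<le> x \<Longrightarrow> x \<le> real i * u \<Longrightarrow> \<bar>exp (- x) - 1 + x\<bar> \<le> y" for u y i
  proof -
    define x where "x = (\<lambda>a::nat. real a * u * ln 2)"
    \<comment> \<open>Summed over \<open>a\<close>, this is the change of \<open>geo_coeff\<close>
      from 0 to \<open>u\<close> with the first-order change of the powers of 2 removed.\<close>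
    define g where "g = (\<lambda>a. (1/2) ^ a * (exp (- x a) * reg_coeff u (i - a) - reg_coeff 0 (i - a) + x a * reg_coeff 0 (i - a)))"
    define m where "m = (\<Sum>b=0..i. real (i - b) * (reg_coeff 0 b * 2 ^ b))"
    have x0: "x a \<ge> 0" for a using u by (simp add: x_def)
    have pw: "(2 powr - (1 + u)) ^ a = (1/2) ^ a * exp (- x a)" for a
    proof -
      have e: "2 powr - (1 + u) = (1/2) * exp (- (u * ln 2))"
        by (simp add: powr_def exp_minus exp_add algebra_simps exp_diff inverse_eq_divide)
      show ?thesis
        unfolding e power_mult_distrib x_def exp_of_nat_mult[symmetric] by (simp add: mult.assoc)
    qed
    have g: "\<bar>g a\<bar> \<le> C * (u + y) * ((1/2) ^ a * (2/5) ^ (i - a))" if "a \<in> {0..i}" for a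
    proof -
      have "x a \<le> real i * u * 1"
        unfolding x_def using that u ln2_le_1 by (intro mult_mono) auto
      hence e: "\<bar>exp (- x a) - 1 + x a\<bar> \<le> y" using y[OF x0] by simp
      have "g a = (1/2) ^ a * (exp (- x a) * (reg_coeff u (i - a) - reg_coeff 0 (i - a)) +
            (exp (- x a) - 1 + x a) * reg_coeff 0 (i - a))"
        by (simp add: g_def algebra_simps)
      also have "\<bar>\<dots>\<bar> \<le> (1/2) ^ a * (1 * (C * u * (2/5) ^ (i - a)) + y * (C * (2/5) ^ (i - a)))"
        unfolding abs_mult
      proof (intro mult_mono order.trans[OF abs_triangle_ineq] add_mono)
        show "\<bar>exp (- x a) * (reg_coeff u (i - a) - reg_coeff 0 (i - a))\<bar> \<le> 1 * (C * u * (2/5) ^ (i - a))"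
          unfolding abs_mult by (intro mult_mono C u) (auto simp: x0)
        show "\<bar>(exp (- x a) - 1 + x a) * reg_coeff 0 (i - a)\<bar> \<le> y * (C * (2/5) ^ (i - a))"
          unfolding abs_mult by (intro mult_mono C e) (auto simp: y0)
      qed auto
      finally show ?thesis by (simp add: algebra_simps)
    qed
    have "\<bar>\<Sum>a=0..i. g a\<bar> \<le> (\<Sum>a=0..i. C * (u + y) * ((1/2) ^ a * (2/5) ^ (i - a)))"
      by (intro order.trans[OF sum_abs] sum_mono g)
    also have "\<dots> = C * (u + y) * (\<Sum>a=0..i. (1/2) ^ a * (2/5) ^ (i - a))"
      by (simp add: sum_distrib_left)
    also have "\<dots> \<le> C * (u + y) * (5 * (1/2) ^ i)"
      using C u y0 half_two_fifths_convolution by (intro mult_left_mono) auto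
    finally have G: "\<bar>\<Sum>a=0..i. g a\<bar> \<le> 5 * C * (1/2) ^ i * (u + y)" by (simp add: mult_ac)
    have "(\<Sum>a=0..i. (1/2) ^ a * (x a * reg_coeff 0 (i - a))) = (\<Sum>a=0..i. ln 2 * u * (1/2) ^ i * (real a * (reg_coeff 0 (i - a) * 2 ^ (i - a))))"
    proof (intro sum.cong refl)
      fix a assume "a \<in> {0..i}"
      hence "(1/2 :: real) ^ i = (1/2) ^ a * (1/2) ^ (i - a)" by (simp flip: power_add)
      thus "(1/2) ^ a * (x a * reg_coeff 0 (i - a)) = ln 2 * u * (1/2) ^ i * (real a * (reg_coeff 0 (i - a) * 2 ^ (i - a)))"
        by (simp add: x_def power_divide)
    qed
    also have "\<dots> = ln 2 * u * (1/2) ^ i * (\<Sum>a=0..i. real a * (reg_coeff 0 (i - a) * 2 ^ (i - a)))"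
      by (simp add: sum_distrib_left)
    also have "(\<Sum>a=0..i. real a * (reg_coeff 0 (i - a) * 2 ^ (i - a))) = m"
      unfolding m_def by (rule sum.reindex_bij_witness[of _ "\<lambda>b. i - b" "\<lambda>b. i - b"]) auto
    finally have X: "(\<Sum>a=0..i. (1/2) ^ a * (x a * reg_coeff 0 (i - a))) = ln 2 * u * (1/2) ^ i * m" .
    have h0: "geo_coeff 0 i = (\<Sum>a=0..i. (1/2) ^ a * reg_coeff 0 (i - a))"
      by (simp add: geo_coeff_def powr_minus inverse_eq_divide)
    have "(\<Sum>a=0..i. g a) = geo_coeff u i - geo_coeff 0 i + ln 2 * u * (1/2) ^ i * m"
      unfolding X[symmetric] h0 geo_coeff_def[of u] pw g_def
      by (simp add: sum.distrib sum_subtractf right_diff_distrib distrib_left mult.assoc)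
    \<comment> \<open>Replacing \<open>m\<close> by \<open>i * d_const\<close> costs at most
      \<open>D\<close>.\<close>
    hence "geo_coeff u i - geo_coeff 0 i + ln 2 * d_const * real i * (1/2) ^ i * u
        = (\<Sum>a=0..i. g a) + ln 2 * (u * ((1/2) ^ i * (real i * d_const - m)))"
      by (simp add: algebra_simps)
    also have "\<bar>\<dots>\<bar> \<le> 5 * C * (1/2) ^ i * (u + y) + 1 * (u * ((1/2) ^ i * D))"
    proof (intro order.trans[OF abs_triangle_ineq] add_mono G)
      show "\<bar>ln 2 * (u * ((1/2) ^ i * (real i * d_const - m)))\<bar> \<le> 1 * (u * ((1/2) ^ i * D))"
        unfolding abs_mult m_def using u ln2_le_1 D by (intro mult_mono) auto
    qed
    also have "\<dots> \<le> 5 * C * (1/2) ^ i * (u + y) + D * (1/2) ^ i * (u + y)"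
      using D y0 by (simp add: algebra_simps)
    finally show ?thesis by (simp add: algebra_simps)
  qed
  show ?thesis
  proof
    show "5 * C + D > 0" using C D by simp
    fix u :: real and i assume u: "0 \<le> u" "u \<le> 1"
    show "\<bar>geo_coeff u i - geo_coeff 0 i + ln 2 * d_const * real i * (1/2) ^ i * u\<bar>
         \<le> (5 * C + D) * (1/2) ^ i * (u + real i * u)"
      using u exp_minus_bounds(1) by (intro main) (auto intro: order.trans)
    show "\<bar>geo_coeff u i - geo_coeff 0 i + ln 2 * d_const * real i * (1/2) ^ i * u\<bar>
         \<le> (5 * C + D) * (1/2) ^ i * (u + (real i * u)\<^sup>2)"
    proof (intro main u)
      fix x assume "0 \<le> x" "x \<le> real i * u"
      thus "\<bar>exp (- x) - 1 + x\<bar> \<le> (real i * u)\<^sup>2"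
        using exp_minus_bounds(2)[of x] power_mono[of x "real i * u" 2] by linarith
    qed auto
  qed
qed

lemma geo_coeff_0_partial_sum:
  obtains C where "C > 0" "\<And>k. \<bar>(\<Sum>i\<le>k. geo_coeff 0 i) - 1\<bar> \<le> C * (1/2) ^ k"
proof -
  obtain C where C: "C > 0" "\<And>u i. 0 \<le> u \<Longrightarrow> u \<le> 1 \<Longrightarrow> \<bar>geo_coeff u i\<bar> \<le> C * (1/2) ^ i"
    using geo_coeff_bound by metis
  show ?thesis
  proof
    show "C > 0" by fact
    fix k
    have "(\<lambda>i. geo_coeff 0 (i + Suc k)) sums (1 - (\<Sum>i<Suc k. geo_coeff 0 i))"
      using sums_geo_coeff_0 by (subst sums_iff_shift) simp
    hence eq: "1 - (\<Sum>i\<le>k. geo_coeff 0 i) = (\<Sum>i. geo_coeff 0 (i + Suc k))"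
      by (simp add: sums_iff lessThan_Suc_atMost)
    have s: "(\<lambda>i. C * (1/2) ^ Suc k * (1/2) ^ i) sums (C * (1/2) ^ Suc k * 2)"
      using sums_mult[OF geometric_sums[of "1/2::real"], of "C * (1/2) ^ Suc k"] by simp
    have "norm (\<Sum>i. geo_coeff 0 (i + Suc k)) \<le> (\<Sum>i. C * (1/2) ^ Suc k * (1/2) ^ i)"
      using C(2)[of 0 "_ + Suc k"]
      by (intro norm_suminf_le sums_summable[OF s]) (auto simp: power_add mult_ac)
    also have "\<dots> = C * (1/2) ^ k" using sums_unique[OF s] by simp
    finally show "\<bar>(\<Sum>i\<le>k. geo_coeff 0 i) - 1\<bar> \<le> C * (1/2) ^ k"
      unfolding eq[symmetric] by (simp add: abs_minus_commute)
  qed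
qed

text \<open>At \<open>u = 1\<close> the logarithm vanishes, so only the term \<open>i = k\<close> of
  the expansion survives, with \<open>0 ^ 0 = 1\<close>.\<close>

lemma almost_prime_zeta_2_bound:
  obtains C where "C > 0" "\<And>k. almost_prime_zeta k 2 \<le> C * (1/2) ^ k"
proof -
  obtain C where C: "C > 0" "\<And>u i. 0 \<le> u \<Longrightarrow> u \<le> 1 \<Longrightarrow> \<bar>geo_coeff u i\<bar> \<le> C * (1/2) ^ i"
    using geo_coeff_bound by metis
  show ?thesis
  proof
    show "C > 0" by fact
    fix k
    have "almost_prime_zeta k (1 + 1) = (\<Sum>i\<le>k. (- ln 1) ^ (k - i) / fact (k - i) * geo_coeff 1 i)"
      by (rule almost_prime_zeta_expansion) simp
    also have "\<dots> = (\<Sum>i\<le>k. if i = k then geo_coeff 1 i else 0)"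
      by (intro sum.cong) (auto simp: zero_power)
    also have "\<dots> = geo_coeff 1 k" by simp
    finally show "almost_prime_zeta k 2 \<le> C * (1/2) ^ k"
      using C(2)[of 1 k] by simp
  qed
qed

section \<open>Integration\<close>

text \<open>For \<open>c > 0\<close>, \<open>erlang_density j c\<close> without its normalising
  factor \<open>c ^ Suc j\<close>. With \<open>u = exp (- t)\<close>, the values 1, 2, 3 of
  \<open>c\<close> stand for the weights 1, \<open>u\<close> and \<open>u\<^sup>2\<close> against
  \<open>du\<close>.\<close>

definition erlang_kernel :: "real \<Rightarrow> nat \<Rightarrow> real \<Rightarrow> real" where
  "erlang_kernel c j t = indicator {0..} t * (t ^ j / fact j * exp (- c * t))"

lemma has_bochner_integral_erlang_kernel:
  assumes "c > 0"
  shows "has_bochner_integral lborel (erlang_kernel c j) (1 / c ^ Suc j)"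
proof -
  have "has_bochner_integral lborel (erlang_density j c) 1"
    using nn_integral_erlang_ith_moment[OF assms, of j 0] assms
    by (intro has_bochner_integral_nn_integral) auto
  from has_bochner_integral_mult_right[OF this, of "1 / c ^ Suc j"]
  have "has_bochner_integral lborel (\<lambda>t. 1 / c ^ Suc j * erlang_density j c t) (1 / c ^ Suc j)"
    by simp
  also have "(\<lambda>t. 1 / c ^ Suc j * erlang_density j c t) = erlang_kernel c j"
    using assms by (auto simp: fun_eq_iff erlang_density_def erlang_kernel_def indicator_def)
  finally show ?thesis .
qed

definition zeta_kernel :: "nat \<Rightarrow> real \<Rightarrow> real" where
  "zeta_kernel k t = indicator {0..} t * (exp (- t) * almost_prime_zeta k (1 + exp (- t)))"

lemma almost_prime_zeta_suminf:
  assumes "s > 1"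
  shows "(\<lambda>n. indicator (almost_primes k) n * real n powr - s) sums almost_prime_zeta k s"
proof -
  have "((\<lambda>n::nat. real n powr - s) has_sum almost_prime_zeta k s) (almost_primes k)"
    unfolding almost_prime_zeta_def by (intro has_sum_infsum summable_on_powr assms)
  hence "((\<lambda>n. indicator (almost_primes k) n * real n powr - s) has_sum almost_prime_zeta k s) UNIV"
    by (rule has_sum_cong_neutral[THEN iffD1, rotated -1]) auto
  thus ?thesis by (rule has_sum_imp_sums)
qed

lemma zeta_kernel_nonneg: "zeta_kernel k t \<ge> 0"
  unfolding zeta_kernel_def almost_prime_zeta_def by (intro mult_nonneg_nonneg infsum_nonneg) auto

text \<open>The range of \<open>u\<close> up to 1 misses \<open>1 / (n\<^sup>2 * ln n)\<close> of
  the full value \<open>1 / (n * ln n)\<close>; hence the factor \<open>1 - 1 / n\<close>.\<close>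

lemma nn_integral_powr_kernel:
  assumes n: "n \<ge> 2"
  shows "(\<integral>\<^sup>+t. ennreal (indicator {0..} t * (exp (- t) * real n powr - (1 + exp (- t)))) \<partial>lborel)
         = ennreal ((1 - 1 / real n) / (real n * ln (real n)))"
proof -
  define F where "F = (\<lambda>t. real n powr - (1 + exp (- t)) / ln (real n))"
  have ln: "ln (real n) > 0" using n by simp
  have "(\<integral>\<^sup>+t. ennreal (exp (- t) * real n powr - (1 + exp (- t))) * indicator {0..} t \<partial>lborel)
        = ennreal (real n powr - (1 + 0) / ln (real n) - F 0)"
  proof (rule nn_integral_FTC_atLeast)
    show "(F has_real_derivative exp (- t) * real n powr - (1 + exp (- t))) (at t)" for t
      unfolding F_def using n ln by (auto intro!: derivative_eq_intros simp: field_simps)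
    have "((\<lambda>t::real. exp (- t)) \<longlongrightarrow> 0) at_top"
      by (intro filterlim_compose[OF exp_at_bot] filterlim_uminus_at_bot_at_top)
    thus "(F \<longlongrightarrow> real n powr - (1 + 0) / ln (real n)) at_top"
      unfolding F_def using n ln by (intro tendsto_intros) auto
  qed auto
  also have "real n powr - (1 + 0) / ln (real n) - F 0 = (1 - 1 / real n) / (real n * ln (real n))"
    using n ln by (simp add: F_def powr_minus field_simps power2_eq_square)
  also have "(\<lambda>t. ennreal (exp (- t) * real n powr - (1 + exp (- t))) * indicator {0..} t) =
      (\<lambda>t. ennreal (indicator {0..} t * (exp (- t) * real n powr - (1 + exp (- t)))))"
    by (auto simp: fun_eq_iff indicator_def)
  finally show ?thesis .
qed

text \<open>Nonnegative terms can be integrated one by one in \<open>ennreal\<close> before the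
  kernel is known to be integrable; that follows later by comparison with \<open>main_kernel\<close>
  and \<open>error_kernel\<close>.\<close>

lemma nn_integral_zeta_kernel:
  assumes k: "k \<ge> 1"
  shows "zeta_kernel k \<in> borel_measurable lborel"
    and "(\<integral>\<^sup>+t. ennreal (zeta_kernel k t) \<partial>lborel) =
      (\<Sum>n. ennreal (indicator (almost_primes k) n * ((1 - 1 / real n) / (real n * ln (real n)))))"
proof -
  define h where "h = (\<lambda>n t. indicator (almost_primes k) n * (indicator {0..} t * (exp (- t) * real n powr - (1 + exp (- t)))))"
  have hm: "h n \<in> borel_measurable lborel" for n
    unfolding h_def by measurable
  have h0: "h n t \<ge> 0" for n t by (simp add: h_def)
  have hs: "(\<lambda>n. h n t) sums zeta_kernel k t" for t
    using sums_mult[OF almost_prime_zeta_suminf[of "1 + exp (- t)" k], of "indicator {0..} t * exp (- t)"]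
    by (simp add: h_def zeta_kernel_def mult_ac)
  have eq: "zeta_kernel k = (\<lambda>t. \<Sum>n. h n t)"
    using sums_unique[OF hs] by auto
  show "zeta_kernel k \<in> borel_measurable lborel"
    unfolding eq by (intro borel_measurable_suminf hm)
  have "(\<integral>\<^sup>+t. ennreal (zeta_kernel k t) \<partial>lborel) = (\<integral>\<^sup>+t. (\<Sum>n. ennreal (h n t)) \<partial>lborel)"
    by (intro nn_integral_cong suminf_ennreal_eq[symmetric] h0 hs)
  also have "\<dots> = (\<Sum>n. \<integral>\<^sup>+t. ennreal (h n t) \<partial>lborel)"
    using hm by (intro nn_integral_suminf) auto
  finally have "(\<integral>\<^sup>+t. ennreal (zeta_kernel k t) \<partial>lborel) = (\<Sum>n. \<integral>\<^sup>+t. ennreal (h n t) \<partial>lborel)" .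
  moreover have "(\<integral>\<^sup>+t. ennreal (h n t) \<partial>lborel) =
      ennreal (indicator (almost_primes k) n * ((1 - 1 / real n) / (real n * ln (real n))))" for n
  proof (cases "n \<in> almost_primes k")
    case True
    hence "n \<noteq> 0" "n \<noteq> 1" using k by (auto simp: almost_primes_def prime_Omega_def)
    hence "n \<ge> 2" by simp
    thus ?thesis using True nn_integral_powr_kernel[of n] by (simp add: h_def)
  qed (simp add: h_def)
  ultimately show "(\<integral>\<^sup>+t. ennreal (zeta_kernel k t) \<partial>lborel) =
      (\<Sum>n. ennreal (indicator (almost_primes k) n * ((1 - 1 / real n) / (real n * ln (real n)))))" by simp
qed

text \<open>In all kernels \<open>u = exp (- t)\<close>, so that \<open>- ln u = t\<close> and the integral over \<open>u\<close> in
  \<open>{0<..1}\<close> becomes one over \<open>t\<close> in \<open>{0..}\<close> with weight \<open>exp (- t)\<close>.\<close>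
definition main_kernel :: "nat \<Rightarrow> real \<Rightarrow> real" where
  "main_kernel k t = (\<Sum>i\<le>k. geo_coeff 0 i * erlang_kernel 1 (k - i) t
     - ln 2 * d_const * real i * (1/2) ^ i * erlang_kernel 2 (k - i) t)"

text \<open>\<open>J\<close> is the crossover in \<open>k - i\<close> between the linear and the
  quadratic error of \<open>geo_coeff_expansion\<close>; each further factor \<open>u\<close> raises
  the rate of \<open>erlang_kernel\<close> by 1.\<close>

definition error_kernel :: "nat \<Rightarrow> nat \<Rightarrow> real \<Rightarrow> real" where
  "error_kernel k J t = (\<Sum>i\<le>k. (1/2) ^ i * (if k - i < J
     then (1 + real i) * erlang_kernel 2 (k - i) t
     else erlang_kernel 2 (k - i) t + (real i)\<^sup>2 * erlang_kernel 3 (k - i) t))"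

text \<open>The constant does not depend on \<open>J\<close>, so the crossover can be chosen later
  as a function of \<open>k\<close>.\<close>

lemma zeta_kernel_approx:
  obtains C where "C > 0"
    "\<And>k J t. \<bar>zeta_kernel k t - main_kernel k t\<bar> \<le> C * error_kernel k J t"
proof -
  obtain C where C: "C > 0"
    "\<And>u i. 0 \<le> u \<Longrightarrow> u \<le> 1 \<Longrightarrow>
       \<bar>geo_coeff u i - geo_coeff 0 i + ln 2 * d_const * real i * (1/2) ^ i * u\<bar>
         \<le> C * (1/2) ^ i * (u + real i * u)"
    "\<And>u i. 0 \<le> u \<Longrightarrow> u \<le> 1 \<Longrightarrow>
       \<bar>geo_coeff u i - geo_coeff 0 i + ln 2 * d_const * real i * (1/2) ^ i * u\<bar>
         \<le> C * (1/2) ^ i * (u + (real i * u)\<^sup>2)"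
    using geo_coeff_expansion by metis
  show ?thesis
  proof
    show "C > 0" by fact
    fix k J :: nat and t :: real
    show "\<bar>zeta_kernel k t - main_kernel k t\<bar> \<le> C * error_kernel k J t"
    proof (cases "t \<ge> 0")
      case False
      hence "erlang_kernel c j t = 0" for c j by (simp add: erlang_kernel_def)
      thus ?thesis using False by (simp add: zeta_kernel_def main_kernel_def error_kernel_def cong: if_cong)
    next
      case True
      define u where "u = exp (- t)"
      define w where "w = (\<lambda>i. t ^ (k - i) / fact (k - i) * u)"
      define r where "r = (\<lambda>i. geo_coeff u i - geo_coeff 0 i + ln 2 * d_const * real i * (1/2) ^ i * u)"
      define b where "b = (\<lambda>i. if k - i < J then u + real i * u else u + (real i * u)\<^sup>2)"
      have u: "0 < u" "u \<le> 1" using True by (auto simp: u_def)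
      have w: "w i \<ge> 0" for i using True u by (simp add: w_def)
      have e: "erlang_kernel 1 (k - i) t = w i" "erlang_kernel 2 (k - i) t = w i * u"
        "erlang_kernel 3 (k - i) t = w i * u\<^sup>2" for i
        using True by (simp_all add: erlang_kernel_def w_def u_def flip: exp_of_nat_mult exp_add)
      have "zeta_kernel k t = (\<Sum>i\<le>k. w i * geo_coeff u i)"
        using True almost_prime_zeta_expansion[OF u(1), of k]
        by (simp add: zeta_kernel_def w_def sum_distrib_left mult_ac flip: u_def) (simp add: u_def)
      hence "zeta_kernel k t - main_kernel k t = (\<Sum>i\<le>k. w i * r i)"
        unfolding main_kernel_def e r_def by (simp add: sum_subtractf[symmetric] algebra_simps)
      also have "\<bar>\<dots>\<bar> \<le> (\<Sum>i\<le>k. w i * (C * (1/2) ^ i * b i))"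
      proof (intro order.trans[OF sum_abs] sum_mono)
        fix i
        have "\<bar>r i\<bar> \<le> C * (1/2) ^ i * b i"
          unfolding r_def b_def using C(2,3)[of u i] u by (cases "k - i < J") auto
        thus "\<bar>w i * r i\<bar> \<le> w i * (C * (1/2) ^ i * b i)"
          unfolding abs_mult using w[of i] by (simp add: mult_left_mono)
      qed
      also have "\<dots> = C * error_kernel k J t"
        unfolding error_kernel_def sum_distrib_left e
        by (intro sum.cong refl) (auto simp: b_def algebra_simps power2_eq_square)
      finally show ?thesis .
    qed
  qed
qed

text \<open>In the linear terms the powers of \<open>1/2\<close> from \<open>i\<close> and from the
  integral combine to one independent of \<open>i\<close>, leaving the sum of the \<open>i\<close>:
  this is the origin of \<open>k\<^sup>2\<close>.\<close>

lemma has_bochner_integral_main_kernel: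
  "has_bochner_integral lborel (main_kernel k)
     ((\<Sum>i\<le>k. geo_coeff 0 i) - ln 2 / 4 * d_const * (1/2) ^ k * (real k * (real k + 1)))"
proof -
  have "has_bochner_integral lborel (main_kernel k)
    (\<Sum>i\<le>k. geo_coeff 0 i * (1 / 1 ^ Suc (k - i)) - ln 2 * d_const * real i * (1/2) ^ i * (1 / 2 ^ Suc (k - i)))"
    unfolding main_kernel_def [abs_def]
    by (intro has_bochner_integral_sum has_bochner_integral_diff has_bochner_integral_mult_right
          has_bochner_integral_erlang_kernel) auto
  also have "(\<Sum>i\<le>k. geo_coeff 0 i * (1 / 1 ^ Suc (k - i)) - ln 2 * d_const * real i * (1/2) ^ i * (1 / 2 ^ Suc (k - i)))
      = (\<Sum>i\<le>k. geo_coeff 0 i - ln 2 / 2 * d_const * (1/2) ^ k * real i)"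
  proof (intro sum.cong refl)
    fix i assume "i \<in> {..k}"
    hence "(1/2 :: real) ^ k = (1/2) ^ i * (1/2) ^ (k - i)" by (simp flip: power_add)
    thus "geo_coeff 0 i * (1 / 1 ^ Suc (k - i)) - ln 2 * d_const * real i * (1/2) ^ i * (1 / 2 ^ Suc (k - i))
       = geo_coeff 0 i - ln 2 / 2 * d_const * (1/2) ^ k * real i"
      by (simp add: power_divide)
  qed
  also have "\<dots> = (\<Sum>i\<le>k. geo_coeff 0 i) - ln 2 / 2 * d_const * (1/2) ^ k * (\<Sum>i\<le>k. real i)"
    by (simp add: sum_subtractf sum_distrib_left)
  also have "(\<Sum>i\<le>k. real i) = real k * (real k + 1) / 2"
    using double_gauss_sum[of k, where 'a = real] by (simp add: atLeast0AtMost)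
  finally show ?thesis by (simp add: mult_ac)
qed

lemma truncated_geometric_sum_le:
  fixes a b :: real
  assumes "a \<ge> 0" "b \<ge> 0"
  shows "(\<Sum>j<n. if j < J then a else b * (2/3) ^ j) \<le> a * real J + 3 * b * (2/3) ^ J"
proof -
  \<comment> \<open>With \<open>min\<close> and \<open>max\<close> the bound grows by exactly the
    new term, as \<open>3 * b * ((2/3) ^ n - (2/3) ^ Suc n) = b * (2/3) ^ n\<close>.\<close>
  have "(\<Sum>j<n. if j < J then a else b * (2/3) ^ j) \<le>
        a * real (min n J) + 3 * b * ((2/3) ^ J - (2/3) ^ max n J)"
  proof (induction n)
    case (Suc n)
    show ?case
    proof (cases "n < J")
      case True
      thus ?thesis using Suc by (simp add: min_def max_def algebra_simps)
    next
      case False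
      thus ?thesis using Suc by (simp add: min_def max_def algebra_simps split: if_splits)
    qed
  qed simp
  also have "\<dots> \<le> a * real J + 3 * b * ((2/3) ^ J - 0)"
    using assms by (intro add_mono mult_left_mono diff_mono) auto
  finally show ?thesis by simp
qed

text \<open>The linear errors cost about \<open>k\<close> for each of at most \<open>J\<close>
  indices. The quadratic ones cost \<open>k\<^sup>2\<close>, but integrating at rate 3 instead of 2
  yields the factor \<open>(2/3) ^ (k - i)\<close>.\<close>

lemma error_kernel_integral:
  assumes "k \<ge> 1"
  obtains I where "has_bochner_integral lborel (error_kernel k J) I"
    "I \<le> (1/2) ^ k * (real k + 1 + real k * real J + 3 * (real k)\<^sup>2 * (2/3) ^ J)"
proof
  define I where "I = (\<Sum>i\<le>k. (1/2) ^ i * (if k - i < J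
     then (1 + real i) * (1 / 2 ^ Suc (k - i))
     else 1 / 2 ^ Suc (k - i) + (real i)\<^sup>2 * (1 / 3 ^ Suc (k - i))))"
  have *: "has_bochner_integral lborel
     (\<lambda>t. if P then a * erlang_kernel 2 j t else erlang_kernel 2 j t + b * erlang_kernel 3 j t)
     (if P then a * (1 / 2 ^ Suc j) else 1 / 2 ^ Suc j + b * (1 / 3 ^ Suc j))" for P a b j
    by (cases P; simp only: if_True if_False;
        intro has_bochner_integral_add has_bochner_integral_mult_right has_bochner_integral_erlang_kernel) auto
  show "has_bochner_integral lborel (error_kernel k J) I"
    unfolding error_kernel_def [abs_def] I_def
    by (intro has_bochner_integral_sum has_bochner_integral_mult_right *)
  have "I \<le> (\<Sum>i\<le>k. (1/2) ^ k * (1 + (if k - i < J then real k else (real k)\<^sup>2 * (2/3) ^ (k - i))))"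
    unfolding I_def
  proof (intro sum_mono)
    fix i assume i: "i \<in> {..k}"
    define q where "q = (1/2 :: real) ^ k"
    have q: "(1/2) ^ i * (1 / 2 ^ Suc (k - i)) = q / 2" "(1/2) ^ i * (1 / 3 ^ Suc (k - i)) = q * (2/3) ^ (k - i) / 3"
    proof -
      have e: "q = (1/2) ^ i * (1/2) ^ (k - i)" using i by (simp add: q_def flip: power_add)
      show "(1/2) ^ i * (1 / 2 ^ Suc (k - i)) = q / 2" by (simp add: e power_divide)
      show "(1/2) ^ i * (1 / 3 ^ Suc (k - i)) = q * (2/3) ^ (k - i) / 3"
        by (simp add: e power_divide)
    qed
    have q0: "q > 0" by (simp add: q_def)
    show "(1/2) ^ i * (if k - i < J then (1 + real i) * (1 / 2 ^ Suc (k - i))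
           else 1 / 2 ^ Suc (k - i) + (real i)\<^sup>2 * (1 / 3 ^ Suc (k - i)))
      \<le> (1/2) ^ k * (1 + (if k - i < J then real k else (real k)\<^sup>2 * (2/3) ^ (k - i)))"
    proof (cases "k - i < J")
      case True
      have "(1/2) ^ i * ((1 + real i) * (1 / 2 ^ Suc (k - i))) = (1 + real i) * (q / 2)"
        using q(1) by (simp only: mult.left_commute)
      also have "\<dots> \<le> (1 + real k) * q" using i q0 by (intro mult_mono) auto
      finally show ?thesis using True by (simp add: q_def mult.commute)
    next
      case False
      have "(1/2) ^ i * (1 / 2 ^ Suc (k - i) + (real i)\<^sup>2 * (1 / 3 ^ Suc (k - i)))
          = q / 2 + (real i)\<^sup>2 * (q * (2/3) ^ (k - i) / 3)"
        using q by (simp only: distrib_left mult.left_commute)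
      also have "\<dots> \<le> q + (real k)\<^sup>2 * (q * (2/3) ^ (k - i))"
        using i q0 by (intro add_mono mult_mono power_mono) auto
      finally show ?thesis using False by (simp add: q_def algebra_simps)
    qed
  qed
  also have "\<dots> = (1/2) ^ k * (\<Sum>i\<le>k. 1 + (if k - i < J then real k else (real k)\<^sup>2 * (2/3) ^ (k - i)))"
    by (simp add: sum_distrib_left)
  also have "(\<Sum>i\<le>k. 1 + (if k - i < J then real k else (real k)\<^sup>2 * (2/3) ^ (k - i)))
      = (\<Sum>j\<le>k. 1 + (if j < J then real k else (real k)\<^sup>2 * (2/3) ^ j))"
    by (rule sum.reindex_bij_witness[of _ "\<lambda>j. k - j" "\<lambda>j. k - j"]) auto
  also have "\<dots> = real k + 1 + (\<Sum>j<Suc k. if j < J then real k else (real k)\<^sup>2 * (2/3) ^ j)"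
    by (simp only: sum.distrib lessThan_Suc_atMost) simp
  also have "\<dots> \<le> real k + 1 + (real k * real J + 3 * (real k)\<^sup>2 * (2/3) ^ J)"
    by (intro add_left_mono truncated_geometric_sum_le) auto
  finally show "I \<le> (1/2) ^ k * (real k + 1 + real k * real J + 3 * (real k)\<^sup>2 * (2/3) ^ J)"
    by (simp add: add.assoc)
qed

section \<open>From the integral back to \<open>f_sum\<close>\<close>

lemma almost_primes_eq:
  assumes "k \<ge> 1"
  shows "{n. prime_Omega n = k} = almost_primes k"
  using assms by (auto simp: almost_primes_def prime_Omega_def intro!: Nat.gr0I)

lemma almost_primes_ge_2:
  assumes "k \<ge> 1" "n \<in> almost_primes k"
  shows "n \<ge> 2"
proof -
  have "n \<noteq> 0" "n \<noteq> 1" using assms by (auto simp: almost_primes_def prime_Omega_def)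
  thus ?thesis by simp
qed

text \<open>The integral misses the range \<open>u > 1\<close>, whose share is the sum of
  \<open>1 / (n\<^sup>2 * ln n)\<close>; here \<open>ln n\<close> is at least
  \<open>ln 2\<close>.\<close>

lemma f_sum_zeta_kernel:
  assumes k: "k \<ge> 1" and int: "integrable lborel (zeta_kernel k)"
  shows "(\<lambda>n. 1 / (real n * ln (real n))) summable_on {n. prime_Omega n = k}"
    and "\<bar>f_sum k - integral\<^sup>L lborel (zeta_kernel k)\<bar> \<le> almost_prime_zeta k 2 / ln 2"
proof -
  define I where "I = integral\<^sup>L lborel (zeta_kernel k)"
  define c where "c = (indicator (almost_primes k) :: nat \<Rightarrow> real)"
  \<comment> \<open>\<open>v\<close> and \<open>w\<close> are the shares of \<open>u\<close> up to 1
    and beyond 1 in the term for \<open>n\<close>.\<close>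
  define v where "v = (\<lambda>n. c n * ((1 - 1 / real n) / (real n * ln (real n))))"
  define w where "w = (\<lambda>n. c n * (1 / ((real n)\<^sup>2 * ln (real n))))"
  have n2: "n \<ge> 2" if "c n \<noteq> 0" for n
    using that almost_primes_ge_2[OF k] by (auto simp: c_def indicator_def split: if_splits)
  have c0: "c n \<ge> 0" for n by (simp add: c_def)
  have v0: "v n \<ge> 0" for n
    using n2[of n] c0 by (cases "c n = 0") (auto simp: v_def)
  have w0: "w n \<ge> 0" for n
    using n2[of n] c0 by (cases "c n = 0") (auto simp: w_def)
  have "(\<Sum>n. ennreal (v n)) = ennreal I"
    using nn_integral_zeta_kernel(2)[OF k] nn_integral_eq_integral[OF int] zeta_kernel_nonneg
    by (simp add: v_def c_def I_def)
  moreover from this have sv: "summable v"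
    using v0 by (intro summable_suminf_not_top) auto
  ultimately have "ennreal (suminf v) = ennreal I"
    using v0 by (simp add: suminf_ennreal2)
  hence "suminf v = I"
    using suminf_nonneg[OF sv] v0 by (subst (asm) ennreal_inj)
      (auto simp: I_def intro!: integral_nonneg_AE zeta_kernel_nonneg)
  with sv have v: "v sums I" by (simp add: sums_iff)
  have z: "(\<lambda>n. c n * real n powr - 2 / ln 2) sums (almost_prime_zeta k 2 / ln 2)"
    unfolding c_def by (intro sums_divide almost_prime_zeta_suminf) auto
  have wz: "w n \<le> c n * real n powr - 2 / ln 2" for n
  proof (cases "c n = 0")
    case False
    hence n: "n \<ge> 2" using n2 by simp
    have "real n powr - 2 = 1 / (real n)\<^sup>2"
      using n by (simp add: powr_minus divide_inverse)
    moreover have "1 / ((real n)\<^sup>2 * ln (real n)) \<le> 1 / ((real n)\<^sup>2 * ln 2)"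
      using n by (intro divide_left_mono mult_left_mono) auto
    ultimately have "c n * (1 / ((real n)\<^sup>2 * ln (real n))) \<le> c n * (real n powr - 2 / ln 2)"
      using c0 by (intro mult_left_mono) auto
    thus ?thesis by (simp add: w_def)
  qed (simp add: w_def)
  have sw: "summable w"
    by (rule summable_comparison_test'[OF sums_summable[OF z], of 0]) (use w0 wz in auto)
  have W: "0 \<le> suminf w" "suminf w \<le> almost_prime_zeta k 2 / ln 2"
    using suminf_nonneg[OF sw] w0 suminf_le[OF _ sw sums_summable[OF z]] wz sums_unique[OF z] by auto
  have eq: "v n + w n = c n * (1 / (real n * ln (real n)))" for n
  proof (cases "c n = 0")
    case False
    hence "real n \<ge> 2" using n2 by simp
    thus ?thesis by (simp add: v_def w_def field_simps power2_eq_square)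
  qed (simp add: v_def w_def)
  have "(\<lambda>n. v n + w n) sums (I + suminf w)"
    using sw by (intro sums_add v summable_sums)
  hence "((\<lambda>n. v n + w n) has_sum (I + suminf w)) UNIV"
    by (rule sums_nonneg_imp_has_sum) (intro add_nonneg_nonneg v0 w0)
  hence "((\<lambda>n. c n * (1 / (real n * ln (real n)))) has_sum (I + suminf w)) UNIV"
    unfolding eq .
  hence f: "((\<lambda>n. 1 / (real n * ln (real n))) has_sum (I + suminf w)) {n. prime_Omega n = k}"
    unfolding almost_primes_eq[OF k]
    by (rule has_sum_cong_neutral[THEN iffD1, rotated -1]) (auto simp: c_def)
  show "(\<lambda>n. 1 / (real n * ln (real n))) summable_on {n. prime_Omega n = k}"
    using f by (rule has_sum_imp_summable)
  have "f_sum k = I + suminf w"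
    unfolding f_sum_def by (rule infsumI[OF f])
  thus "\<bar>f_sum k - integral\<^sup>L lborel (zeta_kernel k)\<bar> \<le> almost_prime_zeta k 2 / ln 2"
    using W by (simp add: I_def)
qed

lemma half_le_ln_2: "1 / 2 \<le> ln (2 :: real)"
  using ln_ge_iff[of 2 "1/2 :: real"] exp_bound[of "1/2"] by (simp add: power2_eq_square)

text \<open>The crossover index: below it the linear bound on the error is used, above it the
  quadratic one, whose geometric weights \<open>(2/3) ^ j\<close> have absorbed a factor \<open>k\<close> by then.\<close>
lemma crossover_index:
  assumes "k \<ge> 1"
  obtains J where "real J \<le> 5 * ln (real k + 1)" "real k * (2/3) ^ J \<le> 1"
proof
  define l where "l = ln (3/2 :: real)"
  \<comment> \<open>Rounding up the logarithm of \<open>k\<close> to base \<open>3/2\<close> gives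
    \<open>(3/2) ^ J\<close> at least \<open>k\<close>.\<close>
  define J where "J = nat \<lceil>ln (real k) / l\<rceil>"
  have l: "l \<ge> 1/3" using ln_le_minus_one[of "2/3 :: real"] ln_inverse[of "3/2 :: real"] by (simp add: l_def)
  have k0: "ln (real k) \<ge> 0" using assms by simp
  have "ln (real k) / l \<le> ln (real k) / (1/3)"
    using l k0 by (intro divide_left_mono) auto
  hence "real J \<le> 3 * ln (real k) + 1"
    using k0 l unfolding J_def by (simp add: of_nat_nat) linarith
  moreover have "ln (real k) \<le> ln (real k + 1)" using assms by simp
  moreover have "ln 2 \<le> ln (real k + 1)" using assms by simp
  \<comment> \<open>The additive 1 is at most \<open>2 * ln (k + 1)\<close>, because
    \<open>ln 2\<close> is at least \<open>1/2\<close>.\<close>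
  ultimately show "real J \<le> 5 * ln (real k + 1)" using half_le_ln_2 by linarith
  have "ln (real k) / l \<le> real J" unfolding J_def using k0 l by (simp add: real_nat_ceiling_ge)
  hence "ln (real k) \<le> real J * l" using l by (simp add: field_simps)
  hence "exp (ln (real k)) \<le> exp (real J * l)" by simp
  also have "exp (real J * l) = (3/2) ^ J" by (simp add: exp_of_nat_mult l_def)
  finally have "real k \<le> (3/2) ^ J" using assms by simp
  hence "real k * (2/3) ^ J \<le> (3/2) ^ J * (2/3) ^ J" by (intro mult_right_mono) auto
  thus "real k * (2/3) ^ J \<le> 1" by (simp flip: power_mult_distrib)
qed

lemma f_sum_estimate:
  obtains C where
    "\<And>k. k \<ge> 1 \<Longrightarrow> (\<lambda>n. 1 / (real n * ln (real n))) summable_on {n. prime_Omega n = k}"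
    "\<And>k. k \<ge> 1 \<Longrightarrow> \<bar>f_sum k - (1 - ln 2 / 4 * (1/2) ^ k * (d_const * (real k)\<^sup>2))\<bar>
       \<le> C * (1/2) ^ k * (real k * ln (real k + 1))"
proof -
  obtain A where A: "A > 0" "\<And>k J t. \<bar>zeta_kernel k t - main_kernel k t\<bar> \<le> A * error_kernel k J t"
    using zeta_kernel_approx by metis
  obtain B where B: "B > 0" "\<And>k. \<bar>(\<Sum>i\<le>k. geo_coeff 0 i) - 1\<bar> \<le> B * (1/2) ^ k"
    using geo_coeff_0_partial_sum by metis
  obtain D where D: "D > 0" "\<And>k. almost_prime_zeta k 2 \<le> D * (1/2) ^ k"
    using almost_prime_zeta_2_bound by metis
  \<comment> \<open>The summands pay for the range \<open>u > 1\<close>, the error kernel, the tail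
    of the constant terms, and the passage from \<open>k * (k + 1)\<close> to
    \<open>k\<^sup>2\<close>.\<close>
  define C where "C = 4 * D + 15 * A + 2 * B + \<bar>d_const\<bar>"
  have int: "integrable lborel (zeta_kernel k)" 
    and est: "\<bar>f_sum k - (1 - ln 2 / 4 * (1/2) ^ k * (d_const * (real k)\<^sup>2))\<bar>
       \<le> C * (1/2) ^ k * (real k * ln (real k + 1))" if k: "k \<ge> 1" for k
  proof -
    define q where "q = (1/2 :: real) ^ k"
    define L where "L = real k * ln (real k + 1)"
    define S where "S = (\<Sum>i\<le>k. geo_coeff 0 i)"
    have q0: "q > 0" by (simp add: q_def)
    obtain J where J: "real J \<le> 5 * ln (real k + 1)" "real k * (2/3) ^ J \<le> 1"
      using crossover_index[OF k] by metis
    obtain I where I: "has_bochner_integral lborel (error_kernel k J) I"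
      "I \<le> q * (real k + 1 + real k * real J + 3 * (real k)\<^sup>2 * (2/3) ^ J)"
      using error_kernel_integral[OF k] unfolding q_def by metis
    define M where "M = S - ln 2 / 4 * d_const * q * (real k * (real k + 1))"
    have M: "has_bochner_integral lborel (main_kernel k) M"
      unfolding M_def S_def q_def by (rule has_bochner_integral_main_kernel)
    have AI: "has_bochner_integral lborel (\<lambda>t. A * error_kernel k J t) (A * I)"
      by (rule has_bochner_integral_mult_right) (rule I)
    have i1: "integrable lborel (\<lambda>t. zeta_kernel k t - main_kernel k t)"
    proof (rule Bochner_Integration.integrable_bound[OF integrable.intros[OF AI]])
      show "(\<lambda>t. zeta_kernel k t - main_kernel k t) \<in> borel_measurable lborel"
        by (intro borel_measurable_diff nn_integral_zeta_kernel(1)[OF k] borel_measurable_has_bochner_integral[OF M])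
      show "AE t in lborel. norm (zeta_kernel k t - main_kernel k t) \<le> norm (A * error_kernel k J t)"
        using A(2)[of k _ J] by (intro AE_I2) (auto intro: order.trans[OF _ abs_ge_self])
    qed
    from Bochner_Integration.integrable_add[OF i1 integrable.intros[OF M]]
    show int: "integrable lborel (zeta_kernel k)" by simp
    have "\<bar>integral\<^sup>L lborel (\<lambda>t. zeta_kernel k t - main_kernel k t)\<bar> \<le> integral\<^sup>L lborel (\<lambda>t. A * error_kernel k J t)"
      using A(2) by (intro integral_abs_bound_integral i1 integrable.intros[OF AI])
    hence 1: "\<bar>integral\<^sup>L lborel (zeta_kernel k) - M\<bar> \<le> A * I"
      by (simp add: Bochner_Integration.integral_diff int integrable.intros[OF M]
          has_bochner_integral_integral_eq[OF M] has_bochner_integral_integral_eq[OF AI] del: integral_mult_right_zero)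
    have "ln 2 \<le> ln (real k + 1)" using k by simp
    hence l: "ln (real k + 1) \<ge> 1/2" using half_le_ln_2 by linarith
    have "real k * (1/2) \<le> L" unfolding L_def using l by (intro mult_left_mono) auto
    hence kL: "real k \<le> 2 * L" "1 \<le> 2 * L" using k by auto
    have "real k * real J \<le> real k * (5 * ln (real k + 1))" using J by (intro mult_left_mono) auto
    hence kJ: "real k * real J \<le> 5 * L" by (simp add: L_def)
    have "3 * real k * (real k * (2/3) ^ J) \<le> 3 * real k * 1" using J by (intro mult_left_mono) auto
    hence kk: "3 * (real k)\<^sup>2 * (2/3) ^ J \<le> 6 * L" using kL by (simp add: power2_eq_square mult.assoc)
    \<comment> \<open>15 is \<open>2 + 2 + 5 + 6\<close>, from \<open>k\<close>, 1,
      \<open>k * J\<close> and the geometric term.\<close>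
    have "I \<le> q * (15 * L)"
      by (rule order.trans[OF I(2)]) (use q0 kL kJ kk in \<open>intro mult_left_mono; simp\<close>)
    hence "A * I \<le> A * (q * (15 * L))" using A by (intro mult_left_mono) auto
    hence 1: "\<bar>integral\<^sup>L lborel (zeta_kernel k) - M\<bar> \<le> 15 * A * q * L" using 1 by (simp add: mult_ac)
    have "almost_prime_zeta k 2 / ln 2 \<le> D * q / (1/2)"
      using D(2)[of k] D(1) q0 half_le_ln_2 unfolding q_def by (intro frac_le) auto
    also have "\<dots> = 2 * D * q * 1" by simp
    also have "\<dots> \<le> 2 * D * q * (2 * L)" using D q0 kL by (intro mult_left_mono) auto
    finally have 2: "\<bar>f_sum k - integral\<^sup>L lborel (zeta_kernel k)\<bar> \<le> 4 * D * q * L"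
      using f_sum_zeta_kernel(2)[OF k int] by simp
    have "B * q * 1 \<le> B * q * (2 * L)" using B q0 kL by (intro mult_left_mono) auto
    hence 3: "\<bar>S - 1\<bar> \<le> 2 * B * q * L" using B(2)[of k] by (simp add: S_def q_def)
    have "\<bar>ln 2 / 4 * (d_const * (q * real k))\<bar> \<le> 1 / 2 * (\<bar>d_const\<bar> * (q * (2 * L)))"
      unfolding abs_mult using ln2_le_1 q0 kL by (intro mult_mono) auto
    hence 4: "\<bar>ln 2 / 4 * d_const * q * real k\<bar> \<le> \<bar>d_const\<bar> * q * L" by (simp add: mult_ac)
    have "f_sum k - (1 - ln 2 / 4 * q * (d_const * (real k)\<^sup>2)) =
       (f_sum k - integral\<^sup>L lborel (zeta_kernel k)) + (integral\<^sup>L lborel (zeta_kernel k) - M) + (S - 1)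
        - ln 2 / 4 * d_const * q * real k"
      by (simp add: M_def algebra_simps power2_eq_square)
    hence "\<bar>f_sum k - (1 - ln 2 / 4 * q * (d_const * (real k)\<^sup>2))\<bar>
       \<le> 4 * D * q * L + 15 * A * q * L + 2 * B * q * L + \<bar>d_const\<bar> * q * L"
      using 1 2 3 4 by linarith
    also have "\<dots> = C * q * L" by (simp add: C_def algebra_simps)
    finally show "\<bar>f_sum k - (1 - ln 2 / 4 * (1/2) ^ k * (d_const * (real k)\<^sup>2))\<bar>
       \<le> C * (1/2) ^ k * (real k * ln (real k + 1))" by (simp add: q_def L_def)
  qed
  show ?thesis
    by (rule that[OF f_sum_zeta_kernel(1)[OF _ int] est])
qed

theorem theorem1p2:
  shows "(\<forall>k\<ge>1. (\<lambda>n. 1 / (real n * ln (real n))) summable_on {n. prime_Omega n = k}) \<and>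
    (\<exists>(E :: nat \<Rightarrow> real) (C :: real).
      (\<forall>k\<ge>1. \<bar>E k\<bar> \<le> C * (real k * ln (real k + 1))) \<and>
      (\<forall>k\<ge>1. f_sum k = 1 - ln 2 / 4 * (1 / 2 ^ k) * (d_const * (real k)\<^sup>2 + E k)))"
proof -
  obtain C where C:
    "\<And>k. k \<ge> 1 \<Longrightarrow> (\<lambda>n. 1 / (real n * ln (real n))) summable_on {n. prime_Omega n = k}"
    "\<And>k. k \<ge> 1 \<Longrightarrow> \<bar>f_sum k - (1 - ln 2 / 4 * (1/2) ^ k * (d_const * (real k)\<^sup>2))\<bar>
       \<le> C * (1/2) ^ k * (real k * ln (real k + 1))"
    by (rule f_sum_estimate) blast
  define R where "R = (\<lambda>k. f_sum k - (1 - ln 2 / 4 * (1/2) ^ k * (d_const * (real k)\<^sup>2)))"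
  \<comment> \<open>Solving the claimed identity for the error term makes the identity automatic;
    only the bound on \<open>E\<close> has content.\<close>
  define E where "E = (\<lambda>k. - (4 / ln 2 * 2 ^ k * R k))"
  have "\<bar>E k\<bar> \<le> 4 / ln 2 * C * (real k * ln (real k + 1))" if "k \<ge> 1" for k
  proof -
    have "\<bar>E k\<bar> = 4 / ln 2 * 2 ^ k * \<bar>R k\<bar>" by (simp add: E_def abs_mult)
    also have "\<dots> \<le> 4 / ln 2 * 2 ^ k * (C * (1/2) ^ k * (real k * ln (real k + 1)))"
      using C(2)[OF that] unfolding R_def by (intro mult_left_mono) auto
    also have "\<dots> = 4 / ln 2 * C * (real k * ln (real k + 1))" by (simp add: power_divide)
    finally show ?thesis .
  qed
  moreover have "f_sum k = 1 - ln 2 / 4 * (1 / 2 ^ k) * (d_const * (real k)\<^sup>2 + E k)" for k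
  proof -
    have "ln 2 / 4 * (1 / 2 ^ k) * E k = - R k" by (simp add: E_def)
    thus ?thesis by (simp add: R_def power_divide distrib_left)
  qed
  ultimately show ?thesis using C(1) by blast
qed

end
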